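(* Let $\mathbf{B}\in\mathbb{R}^{m\times p}$, let $k\ge 1$ be an integer, and let $\mathbf{\Omega}$ be a $p\times q$ random matrix with independent standard normal entries. Let $\mathbf{U}\in\mathbb{R}^{m\times k}$ (orthonormal columns) consist of the top $k$ left singular vectors of $\mathbf{B}\mathbf{\Omega}$, i.e. $\|\mathbf{B}\mathbf{\Omega}-\mathbf{U}\mathbf{U}^{\mathsf T}\mathbf{B}\mathbf{\Omega}\|_F=\|\mathbf{B}\mathbf{\Omega}-[\![\mathbf{B}\mathbf{\Omega}]\!]_k\|_F$. Then, if $q\ge k+2$, $$\mathbb{E}\Big[\|\mathbf{B}-\mathbf{U}\mathbf{U}^{\mathsf T}\mathbf{B}\|_F^2\Big]\le\left(1+\frac{2eq}{\sqrt{(q-k)^2-1}}\right)^2\|\mathbf{B}-[\![\mathbf{B}]\!]_k\|_F^2 .$$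
   Context: $\|\cdot\|_F$ is the Frobenius norm; $[\![\mathbf{M}]\!]_k$ is a best rank-$k$ approximation of $\mathbf{M}$ (truncated SVD); $e$ is Euler's number. $\mathbf{B}$ is deterministic. *)

theory Defs
  imports "HOL-Probability.Probability"
begin

definition frobenius_norm :: "real ^ 'n ^ 'm \<Rightarrow> real" where
  "frobenius_norm A = sqrt (\<Sum>i\<in>UNIV. \<Sum>j\<in>UNIV. (A $ i $ j)\<^sup>2)"

lemma frobenius_norm_eq_norm: "frobenius_norm A = norm A"
  by (simp add: frobenius_norm_def norm_vec_def L2_set_def sum_nonneg)

definition is_best_rank_approx :: "nat \<Rightarrow> real ^ 'n ^ 'm \<Rightarrow> real ^ 'n ^ 'm \<Rightarrow> bool" where
  "is_best_rank_approx k A X \<longleftrightarrow> rank X \<le> k \<and>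
     (\<forall>Y. rank Y \<le> k \<longrightarrow> frobenius_norm (A - X) \<le> frobenius_norm (A - Y))"

lemma open_rank_gt:
  fixes k :: nat
  shows "open {X :: real ^ 'n ^ 'm. k < rank X}"
proof (unfold open_dist, intro ballI)
  fix X :: "real ^ 'n ^ 'm" assume "X \<in> {X. k < rank X}"
  then have rk: "k < rank X" by simp
  define V where "V = span (rows X)"
  have sV: "subspace V" by (simp add: V_def)
  have "\<forall>v\<in>V. X *v v = 0 \<longrightarrow> v = 0"
    using matrix_vector_mul_injective_on_rowspace[of X _ 0] by (simp add: V_def span_zero)
  then obtain c where c: "c > 0" "\<And>v. v \<in> V \<Longrightarrow> norm (X *v v) \<ge> c * norm v"
    using injective_imp_isometric[OF closed_subspace[OF sV] sV, of "(*v) X"]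
    by (auto simp: linear_conv_bounded_linear[symmetric])
  show "\<exists>e>0. \<forall>Y. dist Y X < e \<longrightarrow> Y \<in> {X. k < rank X}"
  proof (intro exI conjI allI impI)
    show "c > 0" by fact
    fix Y assume d: "dist Y X < c"
    have bd: "norm ((Y - X) *v v) \<le> norm (Y - X) * norm v" for v
    proof -
      have "norm ((Y - X) *v v) = L2_set (\<lambda>i. norm (((Y - X) *v v) $ i)) UNIV"
        by (simp add: norm_vec_def)
      also have "\<dots> \<le> L2_set (\<lambda>i. norm v * norm ((Y - X) $ i)) UNIV"
        by (intro L2_set_mono)
           (auto simp: matrix_vector_mul_component mult.commute intro: Cauchy_Schwarz_ineq2[THEN order_trans])
      also have "\<dots> = norm v * norm (Y - X)"
        by (simp add: L2_set_right_distrib[symmetric] norm_vec_def[of "Y - X"])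
      finally show ?thesis by (simp add: mult.commute)
    qed
    have "v = 0" if "v \<in> V" "Y *v v = 0" for v
    proof (rule ccontr)
      assume "v \<noteq> 0"
      have "(Y - X) *v v = - (X *v v)"
        using that by (simp add: matrix_vector_mult_diff_rdistrib)
      then have "c * norm v \<le> norm (Y - X) * norm v"
        using bd[of v] c(2)[OF that(1)] by simp
      then show False using \<open>v \<noteq> 0\<close> d by (simp add: dist_norm)
    qed
    then have "inj_on ((*v) Y) V"
      using linear_inj_on_iff_eq_0[OF matrix_vector_mul_linear sV] by blast
    then have "dim ((*v) Y ` V) = dim V"
      by (intro dim_image_eq) (simp_all only: V_def span_span matrix_vector_mul_linear)
    moreover have "dim ((*v) Y ` V) \<le> dim (range ((*v) Y))"
      by (intro dim_subset) auto
    ultimately have "rank X \<le> rank Y"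
      by (simp add: V_def rank_dim_range[of Y] row_rank_def[of X])
    then show "Y \<in> {X. k < rank X}" using rk by simp
  qed
qed

lemma is_best_rank_approx_exists:
  fixes A :: "real ^ 'n ^ 'm"
  shows "\<exists>X. is_best_rank_approx k A X"
proof -
  have "closed {X :: real ^ 'n ^ 'm. rank X \<le> k}"
    using open_rank_gt[of k, where 'n = 'n and 'm = 'm]
    by (simp add: closed_def Compl_eq not_le)
  moreover have "(0 :: real ^ 'n ^ 'm) \<in> {X. rank X \<le> k}" by simp
  ultimately obtain X where "X \<in> {X :: real ^ 'n ^ 'm. rank X \<le> k}"
    "\<And>Y. Y \<in> {X. rank X \<le> k} \<Longrightarrow> dist A X \<le> dist A Y"
    using distance_attains_inf[of "{X :: real ^ 'n ^ 'm. rank X \<le> k}" A]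
    by (metis (no_types, lifting) empty_iff)
  then show ?thesis
    by (intro exI[of _ X]) (simp add: is_best_rank_approx_def frobenius_norm_eq_norm dist_norm)
qed

(* A best approximation need not be unique, so one is chosen; by minimality
   the residual norm does not depend on the choice. *)
definition best_rank_approx :: "nat \<Rightarrow> real ^ 'n ^ 'm \<Rightarrow> real ^ 'n ^ 'm" where
  "best_rank_approx k A = (SOME X. is_best_rank_approx k A X)"

lemma best_rank_approx: "is_best_rank_approx k A (best_rank_approx k A)"
  unfolding best_rank_approx_def by (rule someI_ex) (rule is_best_rank_approx_exists)

(* Orthonormal columns, together with optimality of the orthogonal projection
   U U^T A among approximations of rank at most k.  The number of vectors is
   carried by the index type of the columns of U. *)
definition top_left_singular_vectors :: "real ^ 'n ^ 'm \<Rightarrow> real ^ 'k ^ 'm \<Rightarrow> bool" where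
  "top_left_singular_vectors A U \<longleftrightarrow> transpose U ** U = mat 1 \<and>
     frobenius_norm (A - U ** transpose U ** A) =
       frobenius_norm (A - best_rank_approx CARD('k) A)"

definition std_gaussian_matrix :: "'a measure \<Rightarrow> ('a \<Rightarrow> real ^ 'q ^ 'p) \<Rightarrow> bool" where
  "std_gaussian_matrix M \<Omega> \<longleftrightarrow>
     prob_space.indep_vars M (\<lambda>_. borel) (\<lambda>(i, j) \<omega>. \<Omega> \<omega> $ i $ j) UNIV \<and>
     (\<forall>i j. distributed M lborel (\<lambda>\<omega>. \<Omega> \<omega> $ i $ j) std_normal_density)"

end

theory Submission
  imports Defs
begin

text \<open>
  Let \<open>K\<close> be a best rank-\<open>k\<close> approximation of \<open>B\<close>, \<open>V\<close> its row space, and \<open>E\<close> the part of \<open>B\<close>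
  whose rows are orthogonal to \<open>V\<close>, so that the norm of \<open>E\<close> is at most that of \<open>B - K\<close>. If
  \<open>\<tau>\<close> is the supremum of \<open>|v| / |v \<Omega>|\<close> over \<open>v\<close> in \<open>V\<close>, then the rows of \<open>B - E\<close> can be recovered from
  \<open>(B - E) \<Omega>\<close> at cost \<open>\<tau>\<close>; comparing the optimal projection of \<open>B \<Omega>\<close> with the competitor
  \<open>(B - E) \<Omega>\<close> gives an error of at most \<open>|E| + 2 \<tau> |E \<Omega>|\<close>. Since \<open>\<tau>\<close> and \<open>E \<Omega>\<close> are
  independent and \<open>|E \<Omega>|\<^sup>2\<close> has mean \<open>q |E|\<^sup>2\<close>, it remains to show that \<open>\<tau>\<^sup>2\<close> has mean at most
  \<open>e\<^sup>2 q / (d\<^sup>2 - 1)\<close> with \<open>d = q - k\<close>.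

  For this, test \<open>V\<close> with an independent Gaussian vector \<open>g\<close>. For fixed \<open>\<Omega>\<close>, the mean over \<open>g\<close> of
  the supremum of \<open>(|v \<bullet> g| / |v \<Omega>|) ^ d\<close> is at least \<open>m \<tau> ^ d\<close>, where \<open>m\<close> is the \<open>d\<close>-th
  absolute moment of a standard normal variable. For fixed \<open>g\<close>, this supremum is bounded by
  \<open>|g'| ^ d\<close>, with \<open>g'\<close> the projection of \<open>g\<close> to \<open>V\<close>, times an inverse \<open>d\<close>-th power of the length of a Gaussian vector
  in dimension \<open>d + 1\<close>, whose mean is exactly \<open>1 / m\<close>. Hence \<open>\<tau> ^ d\<close> has mean at most
  \<open>q powr (d / 2) / m\<^sup>2\<close>, and \<open>m\<^sup>2 \<ge> (d / e) ^ d\<close> by induction in steps of two.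
\<close>

section \<open>The standard Gaussian measure on a Euclidean space\<close>

text \<open>One measure for all Euclidean spaces, so that vectors, matrices and pairs share the same
  lemmas. On matrices \<open>norm\<close> is the Frobenius norm, so this is the law of a matrix with
  independent standard normal entries.\<close>

definition gauss :: "'a::euclidean_space measure" where
  "gauss = density lborel (\<lambda>x. ennreal ((1 / sqrt (2 * pi)) ^ DIM('a) * exp (- (norm x)\<^sup>2 / 2)))"

lemma sets_gauss [measurable_cong, simp]: "sets gauss = sets borel"
  by (simp add: gauss_def)

lemma space_gauss [simp]: "space gauss = UNIV"
  by (simp add: gauss_def)

lemma gauss_density_prod:
  fixes x :: "'a::euclidean_space"
  shows "(1 / sqrt (2 * pi)) ^ DIM('a) * exp (- (norm x)\<^sup>2 / 2) =
    (\<Prod>b\<in>Basis. std_normal_density (x \<bullet> b))"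
proof -
  have "exp (- (norm x)\<^sup>2 / 2) = (\<Prod>b\<in>Basis. exp (- (x \<bullet> b)\<^sup>2 / 2))"
    by (simp add: power2_norm_eq_inner euclidean_inner[of x x] exp_sum[symmetric]
        sum_negf sum_divide_distrib[symmetric] power2_eq_square[of "_ \<bullet> _"])
  then show ?thesis
    by (simp add: std_normal_density_def prod.distrib del: prod_constant)
       (simp add: prod_constant prod_dividef power_one_over field_simps)
qed

lemma nn_integral_gauss:
  fixes f :: "'a::euclidean_space \<Rightarrow> ennreal"
  assumes "f \<in> borel_measurable borel"
  shows "(\<integral>\<^sup>+x. f x \<partial>gauss) = (\<integral>\<^sup>+x. ennreal (\<Prod>b\<in>Basis. std_normal_density (x \<bullet> b)) * f x \<partial>lborel)"
  using assms unfolding gauss_def gauss_density_prod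
  by (subst nn_integral_density) auto

lemma gauss_real: "(gauss :: real measure) = density lborel std_normal_density"
  unfolding gauss_def gauss_density_prod by simp

lemma nn_integral_gauss_prod:
  fixes f :: "'a::euclidean_space \<Rightarrow> real \<Rightarrow> ennreal"
  assumes [measurable]: "\<And>b. b \<in> Basis \<Longrightarrow> f b \<in> borel_measurable borel"
  shows "(\<integral>\<^sup>+x. (\<Prod>b\<in>Basis. f b (x \<bullet> b)) \<partial>gauss) = (\<Prod>b\<in>Basis. \<integral>\<^sup>+y. f b y \<partial>gauss)"
proof -
  have "(\<integral>\<^sup>+x. (\<Prod>b\<in>Basis. f b (x \<bullet> b)) \<partial>(gauss :: 'a measure)) =
     (\<integral>\<^sup>+(x::'a). (\<Prod>b\<in>Basis. ennreal (std_normal_density (x \<bullet> b)) * f b (x \<bullet> b)) \<partial>lborel)"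
    by (subst nn_integral_gauss) (auto simp: prod.distrib prod_ennreal)
  also have "\<dots> = (\<Prod>b\<in>Basis. \<integral>\<^sup>+y. ennreal (std_normal_density y) * f b y \<partial>lborel)"
    by (subst nn_integral_lborel_prod[where f="\<lambda>b y. ennreal (std_normal_density y) * f b y"]) auto
  also have "\<dots> = (\<Prod>b\<in>Basis. \<integral>\<^sup>+y. f b y \<partial>gauss)"
    by (intro prod.cong refl) (simp add: gauss_real nn_integral_density)
  finally show ?thesis .
qed

lemma prob_space_gauss: "prob_space (gauss :: 'a::euclidean_space measure)"
proof
  have "emeasure (gauss :: real measure) UNIV = 1"
    using prob_space.emeasure_space_1[OF prob_space_normal_density[of 1 0]]
    by (simp add: gauss_real)
  then show "emeasure (gauss :: 'a measure) (space gauss) = 1"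
    using nn_integral_gauss_prod[of "\<lambda>(_::'a) _. 1"] by simp
qed

interpretation gauss: prob_space "gauss :: 'a::euclidean_space measure"
  by (rule prob_space_gauss)

interpretation gauss_pair: pair_prob_space
  "gauss :: 'a::euclidean_space measure" "gauss :: 'b::euclidean_space measure" ..

text \<open>Squared norms add in a product space, so the densities multiply. Two independent
  Gaussian vectors thus form a single one, to which rotation invariance applies.\<close>

lemma gauss_pair: "gauss \<Otimes>\<^sub>M gauss = (gauss :: ('a::euclidean_space \<times> 'b::euclidean_space) measure)"
proof -
  have "gauss \<Otimes>\<^sub>M gauss = density (lborel \<Otimes>\<^sub>M lborel)
     (\<lambda>(x::'a, y::'b). ennreal ((1 / sqrt (2 * pi)) ^ DIM('a) * exp (- (norm x)\<^sup>2 / 2)) *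
        ennreal ((1 / sqrt (2 * pi)) ^ DIM('b) * exp (- (norm y)\<^sup>2 / 2)))"
    using gauss.sigma_finite_measure_axioms unfolding gauss_def
    by (intro pair_measure_density) (auto intro: lborel.sigma_finite_measure_axioms)
  also have "\<dots> = gauss"
    unfolding gauss_def lborel_prod
    by (rule arg_cong[where f="density lborel"])
       (auto simp: fun_eq_iff ennreal_mult[symmetric] norm_prod_def power_add
          exp_add[symmetric] add_divide_distrib algebra_simps)
  finally show ?thesis .
qed

section \<open>Invariance under rotations and coisometries\<close>

lemma nn_integral_lborel_translate:
  fixes f :: "'a::euclidean_space \<Rightarrow> ennreal"
  assumes "f \<in> borel_measurable borel"
  shows "(\<integral>\<^sup>+x. f (c + x) \<partial>lborel) = (\<integral>\<^sup>+x. f x \<partial>lborel)"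
  using nn_integral_distr[of "(+) c" "lborel :: 'a measure" borel f] assms
  by (simp add: lborel_distr_plus)

text \<open>Uniqueness of Haar measure: two translation-invariant measures agree up to a factor, and
  the factor is read off from the unit ball.\<close>

lemma lborel_distr_orthogonal:
  fixes f :: "'a::euclidean_space \<Rightarrow> 'a"
  assumes f: "orthogonal_transformation f"
  shows "distr lborel borel f = lborel"
proof (rule measure_eqI)
  fix B assume "B \<in> sets (distr lborel borel f)"
  then have B[measurable]: "B \<in> sets borel" by simp
  have lin: "linear f" using f by (rule orthogonal_transformation_linear)
  then have [measurable]: "f \<in> borel_measurable borel"
    by (intro borel_measurable_continuous_onI linear_continuous_on)
       (simp add: linear_conv_bounded_linear)
  define A where "A = ball (0::'a) 1"
  have [measurable]: "A \<in> sets borel" by (simp add: A_def)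
  define g where "g = inv f"
  have fg: "f (g x) = x" for x
    using orthogonal_transformation_surj[OF f] by (simp add: g_def surj_f_inv_f)
  \<comment> \<open>Invariance of the ball under \<open>f\<close> and negation makes both ends of
    the Fubini computation carry the same factor, the measure of \<open>A\<close>. It is positive
    and finite, so it cancels.\<close>
  have A: "indicator A (f z) = (indicator A z :: ennreal)" "indicator A (- z) = (indicator A z :: ennreal)" for z
    using orthogonal_transformation_norm[OF f] by (auto simp: A_def indicator_def)
  have "emeasure lborel A * emeasure (distr lborel borel f) B =
      (\<integral>\<^sup>+x. indicator A x * (\<integral>\<^sup>+y. indicator B (f y) \<partial>lborel) \<partial>lborel)"
    by (simp add: nn_integral_multc emeasure_distr nn_integral_indicator[symmetric]
         nn_integral_distr del: nn_integral_indicator)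
  also have "\<dots> = (\<integral>\<^sup>+x. \<integral>\<^sup>+y. indicator A x * indicator B (f y + x) \<partial>lborel \<partial>lborel)"
  proof (intro nn_integral_cong)
    fix x
    have "(\<integral>\<^sup>+y. indicator B (f y) \<partial>lborel) = (\<integral>\<^sup>+y. indicator B (f (g x + y)) \<partial>lborel)"
      by (rule nn_integral_lborel_translate[symmetric]) simp
    also have "\<dots> = (\<integral>\<^sup>+y. indicator B (f y + x) \<partial>lborel)"
      by (simp add: linear_add[OF lin] fg add.commute)
    finally show "indicator A x * (\<integral>\<^sup>+y. indicator B (f y) \<partial>lborel) =
        (\<integral>\<^sup>+y. indicator A x * indicator B (f y + x) \<partial>lborel)"
      by (simp add: nn_integral_cmult)
  qed
  also have "\<dots> = (\<integral>\<^sup>+y. \<integral>\<^sup>+x. indicator A x * indicator B (f y + x) \<partial>lborel \<partial>lborel)"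
    by (intro lborel_pair.Fubini') simp
  also have "\<dots> = (\<integral>\<^sup>+y. \<integral>\<^sup>+x. indicator A (x - f y) * indicator B x \<partial>lborel \<partial>lborel)"
  proof (rule nn_integral_cong)
    fix y
    show "(\<integral>\<^sup>+x. indicator A x * indicator B (f y + x) \<partial>lborel) =
       (\<integral>\<^sup>+x. indicator A (x - f y) * indicator B x \<partial>lborel)"
      using nn_integral_lborel_translate[of "\<lambda>x. indicator A (x - f y) * indicator B x" "f y"]
      by simp
  qed
  also have "\<dots> = (\<integral>\<^sup>+x. \<integral>\<^sup>+y. indicator A (x - f y) * indicator B x \<partial>lborel \<partial>lborel)"
    by (intro lborel_pair.Fubini') simp
  also have "\<dots> = (\<integral>\<^sup>+x. emeasure lborel A * indicator B x \<partial>lborel)"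
  proof (intro nn_integral_cong)
    fix x
    have "(\<integral>\<^sup>+y. indicator A (x - f y) \<partial>lborel) = (\<integral>\<^sup>+y. indicator A (- g x + y) \<partial>lborel)"
    proof (intro nn_integral_cong)
      fix y
      have "x - f y = f (- (- g x + y))"
        by (simp add: linear_diff[OF lin] linear_neg[OF lin] fg)
      then show "indicator A (x - f y) = (indicator A (- g x + y) :: ennreal)"
        by (simp only: A)
    qed
    also have "\<dots> = emeasure lborel A"
      by (subst nn_integral_lborel_translate) auto
    finally show "(\<integral>\<^sup>+y. indicator A (x - f y) * indicator B x \<partial>lborel) = emeasure lborel A * indicator B x"
      by (simp add: nn_integral_multc)
  qed
  also have "\<dots> = emeasure lborel A * emeasure lborel B"
    by (simp add: nn_integral_cmult)
  finally have eq: "emeasure lborel A * emeasure (distr lborel borel f) B = emeasure lborel A * emeasure lborel B" .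
  have "emeasure lborel A < \<infinity>"
    unfolding A_def by (rule emeasure_bounded_finite) simp
  moreover have "emeasure lborel A \<noteq> 0"
  proof
    assume "emeasure lborel A = 0"
    then have "A \<in> null_sets lborel" by (simp add: null_sets_def)
    moreover have "open A" "A \<noteq> {}" by (auto simp: A_def)
    ultimately show False
      using negligible_iff_null_sets[of A] open_not_negligible null_sets_completionI by blast
  qed
  ultimately show "emeasure (distr lborel borel f) B = emeasure lborel B"
    using eq by (auto simp: ennreal_mult_cancel_left)
qed simp

lemma gauss_distr_orthogonal:
  fixes f :: "'a::euclidean_space \<Rightarrow> 'a"
  assumes f: "orthogonal_transformation f"
  shows "distr gauss borel f = gauss"
proof -
  have [measurable]: "f \<in> borel_measurable borel"
    using orthogonal_transformation_linear[OF f]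
    by (intro borel_measurable_continuous_onI linear_continuous_on)
       (simp add: linear_conv_bounded_linear)
  have "gauss = density (distr lborel borel f)
      (\<lambda>x. ennreal ((1 / sqrt (2 * pi)) ^ DIM('a) * exp (- (norm x)\<^sup>2 / 2)))"
    by (simp add: gauss_def lborel_distr_orthogonal[OF f])
  also have "\<dots> = distr gauss borel f"
    by (subst density_distr) (auto simp: gauss_def orthogonal_transformation_norm[OF f])
  finally show ?thesis by simp
qed

text \<open>\<open>S\<close> is the adjoint of \<open>T\<close> and also a right inverse. Inner
  products with a unit vector, unit combinations of the rows of a matrix, and sums of complementary
  projections of two vectors are all instances.\<close>

lemma gauss_distr_coisometry:
  fixes T :: "'a::euclidean_space \<Rightarrow> 'b::euclidean_space"
  assumes T: "linear T" and S: "linear S"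
    and adj: "\<And>x y. S y \<bullet> x = y \<bullet> T x" and TS: "\<And>y. T (S y) = y"
  shows "distr gauss borel T = gauss"
proof -
  \<comment> \<open>A coisometry is one component of an orthogonal map on the product space.\<close>
  define f where "f = (\<lambda>(x, y). (S y + x - S (T x), T x))"
  have meas[measurable]: "T \<in> borel_measurable borel" "S \<in> borel_measurable borel"
    using S T
    by (auto intro!: borel_measurable_continuous_onI linear_continuous_on
       simp: linear_conv_bounded_linear)
  have "orthogonal_transformation f"
    unfolding orthogonal_transformation
  proof (intro conjI allI)
    show "linear f"
      by (rule linearI) (auto simp: f_def linear_add[OF S] linear_add[OF T] linear_scale[OF S]
            linear_scale[OF T] algebra_simps)
    fix v :: "'a \<times> 'b"
    obtain x y where v: "v = (x, y)" by force
    have a: "x \<bullet> S z = T x \<bullet> z" "S z \<bullet> x = T x \<bullet> z" "S w \<bullet> S z = w \<bullet> z" for x z w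
      using adj[of z x] adj[of w "S z"] by (simp_all add: inner_commute TS)
    have "f v \<bullet> f v = v \<bullet> v"
      by (simp add: v f_def inner_add_left inner_add_right inner_diff_left inner_diff_right a TS linear_add[OF T] linear_diff[OF T])
         (simp add: inner_commute)
    then show "norm (f v) = norm v" by (simp add: norm_eq_sqrt_inner)
  qed
  then have f: "distr gauss borel f = gauss" by (rule gauss_distr_orthogonal)
  have [measurable]: "f \<in> borel_measurable borel"
    unfolding f_def split_beta' borel_prod[symmetric] by measurable
  have [measurable]: "(fst :: 'a \<times> 'b \<Rightarrow> 'a) \<in> borel_measurable borel"
    "(snd :: 'a \<times> 'b \<Rightarrow> 'b) \<in> borel_measurable borel"
    unfolding borel_prod[symmetric] by measurable
  have snd: "distr (gauss :: ('a \<times> 'b) measure) borel snd = gauss"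
  proof (rule measure_eqI)
    fix A :: "'b set" assume "A \<in> sets (distr (gauss :: ('a \<times> 'b) measure) borel snd)"
    then show "emeasure (distr (gauss :: ('a \<times> 'b) measure) borel snd) A = emeasure gauss A"
      using gauss.emeasure_space_1[where ?'a='a]
      by (simp add: emeasure_distr gauss_pair[symmetric] vimage_snd gauss.emeasure_pair_measure_Times)
  qed simp
  have fst: "distr (gauss :: ('a \<times> 'b) measure) borel fst = gauss"
  proof (rule measure_eqI)
    fix A :: "'a set" assume "A \<in> sets (distr (gauss :: ('a \<times> 'b) measure) borel fst)"
    then show "emeasure (distr (gauss :: ('a \<times> 'b) measure) borel fst) A = emeasure gauss A"
      using gauss.emeasure_space_1[where ?'a='b]
      by (simp add: emeasure_distr gauss_pair[symmetric] vimage_fst gauss.emeasure_pair_measure_Times)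
  qed simp
  have "gauss = distr (distr (gauss :: ('a \<times> 'b) measure) borel f) borel snd"
    by (simp add: f snd)
  also have "\<dots> = distr gauss borel (\<lambda>z :: 'a \<times> 'b. T (fst z))"
    by (subst distr_distr) (auto simp: f_def o_def split_beta')
  also have "\<dots> = distr (distr (gauss :: ('a \<times> 'b) measure) borel fst) borel T"
    by (subst distr_distr) (auto simp: o_def)
  also have "\<dots> = distr gauss borel T" by (simp add: fst)
  finally show ?thesis by simp
qed

lemma nn_integral_gauss_coisometry:
  fixes T :: "'a::euclidean_space \<Rightarrow> 'b::euclidean_space"
  assumes T: "linear T" and S: "linear S"
    and adj: "\<And>x y. S y \<bullet> x = y \<bullet> T x" and TS: "\<And>y. T (S y) = y"
    and F: "F \<in> borel_measurable borel"
  shows "(\<integral>\<^sup>+x. F (T x) \<partial>gauss) = (\<integral>\<^sup>+y. F y \<partial>gauss)"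
proof -
  have "T \<in> borel_measurable borel"
    using T by (auto intro!: borel_measurable_continuous_onI linear_continuous_on
       simp: linear_conv_bounded_linear)
  then have "(\<integral>\<^sup>+x. F (T x) \<partial>gauss) = (\<integral>\<^sup>+y. F y \<partial>(distr gauss borel T))"
    using F by (subst nn_integral_distr) auto
  then show ?thesis using gauss_distr_coisometry[OF T S adj TS] by simp
qed

text \<open>The components along and across a projection are independent: they may be taken from two
  independent Gaussian vectors.\<close>

lemma nn_integral_gauss_split:
  fixes P :: "'a::euclidean_space \<Rightarrow> 'a"
  assumes P: "linear P" and adj: "\<And>x y. P x \<bullet> y = x \<bullet> P y" and idem: "\<And>x. P (P x) = P x"
    and F[measurable]: "F \<in> borel_measurable borel"
  shows "(\<integral>\<^sup>+x. F x \<partial>gauss) = (\<integral>\<^sup>+y. \<integral>\<^sup>+x. F (P x + (y - P y)) \<partial>gauss \<partial>gauss)"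
proof -
  have [measurable]: "P \<in> borel_measurable borel"
    using P by (auto intro!: borel_measurable_continuous_onI linear_continuous_on
       simp: linear_conv_bounded_linear)
  define T where "T = (\<lambda>z. P (snd z) + (fst z - P (fst z)))"
  define S where "S = (\<lambda>z. (z - P z, P z))"
  have [measurable]: "T \<in> borel_measurable (gauss \<Otimes>\<^sub>M gauss)"
    unfolding T_def by measurable
  have "(\<integral>\<^sup>+x. F x \<partial>gauss) = (\<integral>\<^sup>+z. F (T z) \<partial>gauss)"
  proof (rule nn_integral_gauss_coisometry[symmetric])
    show "linear T" "linear S"
      by (rule linearI, auto simp: T_def S_def linear_add[OF P] linear_scale[OF P] algebra_simps)+
    show "S y \<bullet> x = y \<bullet> T x" for x y
      by (simp add: T_def S_def inner_prod_def algebra_simps adj inner_diff_left)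
    show "T (S y) = y" for y
      by (simp add: T_def S_def linear_diff[OF P] idem)
  qed simp
  also have "\<dots> = (\<integral>\<^sup>+y. \<integral>\<^sup>+x. F (P x + (y - P y)) \<partial>gauss \<partial>gauss)"
    unfolding gauss_pair[symmetric]
    by (subst gauss.nn_integral_fst[symmetric]) (auto simp: T_def)
  finally show ?thesis .
qed

section \<open>Gaussian moments\<close>

lemma nn_integral_gauss_inner:
  fixes h :: "'a::euclidean_space"
  assumes h: "norm h = 1" and F: "F \<in> borel_measurable borel"
  shows "(\<integral>\<^sup>+x. F (x \<bullet> h) \<partial>gauss) = (\<integral>\<^sup>+y. F y \<partial>gauss)"
proof -
  have "h \<bullet> h = 1" using h by (simp add: norm_eq_1)
  then show ?thesis
    by (intro nn_integral_gauss_coisometry[where S="\<lambda>y. y *\<^sub>R h"] F)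
       (auto intro!: linearI simp: inner_add_left algebra_simps inner_commute)
qed

text \<open>The case of a rank-one projection, which peels off one orthonormal direction at a
  time.\<close>

lemma nn_integral_gauss_inner_split:
  fixes h :: "'a::euclidean_space"
  assumes h: "norm h = 1" and F: "F \<in> borel_measurable borel"
  shows "(\<integral>\<^sup>+x. F x \<partial>gauss) =
    (\<integral>\<^sup>+y. \<integral>\<^sup>+x. F ((x \<bullet> h) *\<^sub>R h + (y - (y \<bullet> h) *\<^sub>R h)) \<partial>gauss \<partial>gauss)"
proof -
  have "h \<bullet> h = 1" using h by (simp add: norm_eq_1)
  then show ?thesis
    by (intro nn_integral_gauss_split F)
       (auto intro!: linearI simp: inner_add_left algebra_simps inner_commute)
qed

text \<open>Up to the factor \<open>1 / c\<close>, the integrand is the normal density with standard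
  deviation \<open>1 / c\<close>. The range of \<open>t\<close> is that of convergence; negative
  values are used as well as positive ones.\<close>

lemma nn_integral_gauss_exp_square:
  assumes t: "t > - 1 / 2"
  shows "(\<integral>\<^sup>+(y::real). ennreal (exp (- t * y\<^sup>2)) \<partial>gauss) = ennreal ((1 + 2 * t) powr (- 1 / 2))"
proof -
  define c where "c = sqrt (1 + 2 * t)"
  have c: "c > 0" "c\<^sup>2 = 1 + 2 * t" using t by (auto simp: c_def)
  have eq: "std_normal_density y * exp (- t * y\<^sup>2) = (1 / c) * normal_density 0 (1 / c) y" for y
  proof -
    have "exp (- (y\<^sup>2 / 2)) * exp (- t * y\<^sup>2) = exp (- (y\<^sup>2 * c\<^sup>2) / 2)"
      by (simp add: exp_add[symmetric] c(2) field_simps)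
    moreover have "sqrt (2 * pi * (1 / c)\<^sup>2) = sqrt (2 * pi) / c"
      using c(1) by (simp add: real_sqrt_mult real_sqrt_divide power_divide del: real_sqrt_eq_iff)
    ultimately show ?thesis
      using c(1) unfolding normal_density_def by (simp add: power_divide field_simps)
  qed
  have "(\<integral>\<^sup>+(y::real). ennreal (exp (- t * y\<^sup>2)) \<partial>gauss) =
      (\<integral>\<^sup>+y. ennreal (1 / c) * ennreal (normal_density 0 (1 / c) y) \<partial>lborel)"
    using c by (simp add: gauss_real nn_integral_density ennreal_mult'[symmetric] eq[simplified])
  also have "\<dots> = ennreal (1 / c) * emeasure (density lborel (normal_density 0 (1 / c))) UNIV"
    by (simp add: nn_integral_cmult emeasure_density)
  also have "emeasure (density lborel (normal_density 0 (1 / c))) UNIV = 1"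
    using prob_space.emeasure_space_1[OF prob_space_normal_density[of "1 / c" 0]] c by simp
  also have "1 / c = (1 + 2 * t) powr (- 1 / 2)"
    using t by (simp add: c_def powr_minus powr_half_sqrt divide_simps)
  finally show ?thesis by simp
qed

text \<open>The sum is chi-squared with \<open>card S\<close> degrees of freedom; the induction
  splits off one direction, independent of the others. Nonnegative \<open>t\<close> serves the
  inverse moments, negative \<open>t\<close> the Chernoff bound.\<close>

lemma nn_integral_gauss_exp_sum_squares:
  fixes S :: "'a::euclidean_space set"
  assumes "finite S" "pairwise orthogonal S" "\<And>h. h \<in> S \<Longrightarrow> norm h = 1" and t: "t > - 1 / 2"
  shows "(\<integral>\<^sup>+x. ennreal (exp (- t * (\<Sum>h\<in>S. (x \<bullet> h)\<^sup>2))) \<partial>gauss) =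
     ennreal ((1 + 2 * t) powr (- real (card S) / 2))"
  using assms(1-3)
proof (induction S)
  case empty
  then show ?case using t gauss.emeasure_space_1 by simp
next
  case (insert h S)
  have h: "norm h = 1" "h \<bullet> h = 1" using insert.prems(2) by (auto simp: norm_eq_1)
  have orth: "h \<bullet> h' = 0" if "h' \<in> S" for h'
    using insert.prems(1) insert.hyps that
    by (auto simp: pairwise_insert orthogonal_def)
  have "(\<integral>\<^sup>+x. ennreal (exp (- t * (\<Sum>h\<in>insert h S. (x \<bullet> h)\<^sup>2))) \<partial>gauss) =
    (\<integral>\<^sup>+y. \<integral>\<^sup>+x. ennreal (exp (- t * (x \<bullet> h)\<^sup>2)) * ennreal (exp (- t * (\<Sum>h\<in>S. (y \<bullet> h)\<^sup>2))) \<partial>gauss \<partial>gauss)"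
    using insert.hyps h orth
    by (subst nn_integral_gauss_inner_split[OF h(1)])
       (simp_all add: inner_add_left inner_diff_left ennreal_mult'[symmetric] exp_add[symmetric]
          distrib_left)
  also have "\<dots> = (\<integral>\<^sup>+y. ennreal ((1 + 2 * t) powr (- 1 / 2)) *
      ennreal (exp (- t * (\<Sum>h\<in>S. (y \<bullet> h)\<^sup>2))) \<partial>gauss)"
  proof (rule nn_integral_cong)
    fix y :: 'a
    show "(\<integral>\<^sup>+x. ennreal (exp (- t * (x \<bullet> h)\<^sup>2)) * ennreal (exp (- t * (\<Sum>h\<in>S. (y \<bullet> h)\<^sup>2))) \<partial>gauss) =
      ennreal ((1 + 2 * t) powr (- 1 / 2)) * ennreal (exp (- t * (\<Sum>h\<in>S. (y \<bullet> h)\<^sup>2)))"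
      using nn_integral_gauss_inner[OF h(1), of "\<lambda>y. ennreal (exp (- t * y\<^sup>2))"]
        nn_integral_gauss_exp_square[OF t]
      by (subst nn_integral_multc) auto
  qed
  also have "\<dots> = ennreal ((1 + 2 * t) powr (- 1 / 2)) * ennreal ((1 + 2 * t) powr (- real (card S) / 2))"
    using insert by (subst nn_integral_cmult) (auto simp: pairwise_insert)
  also have "\<dots> = ennreal ((1 + 2 * t) powr (- real (card (insert h S)) / 2))"
    using insert.hyps by (simp add: ennreal_mult'[symmetric] powr_add[symmetric] field_simps add_divide_distrib)
  finally show ?case .
qed

text \<open>The \<open>n\<close>-th absolute moment of a standard normal variable, as
  \<open>nn_integral_gauss_abs_power\<close> shows. The Gamma form covers both parities and is the
  one in which the inverse moment of the length comes out.\<close>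

definition normal_abs_moment :: "nat \<Rightarrow> real" where
  "normal_abs_moment n = 2 powr (real n / 2) * Gamma ((real n + 1) / 2) / sqrt pi"

lemma normal_abs_moment_pos: "normal_abs_moment n > 0"
  by (simp add: normal_abs_moment_def Gamma_real_pos)

lemma normal_abs_moment_rec: "normal_abs_moment (n + 2) = (real n + 1) * normal_abs_moment n"
proof -
  have "Gamma ((real (n + 2) + 1) / 2) = Gamma ((real n + 1) / 2 + 1)"
    by (rule arg_cong[where f=Gamma]) (simp add: field_simps)
  also have "\<dots> = (real n + 1) / 2 * Gamma ((real n + 1) / 2)"
    by (rule Gamma_plus1) (auto elim!: nonpos_Ints_cases)
  finally have 1: "Gamma ((real (n + 2) + 1) / 2) = (real n + 1) / 2 * Gamma ((real n + 1) / 2)" .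
  have 2: "(2::real) powr (real (n + 2) / 2) = 2 * 2 powr (real n / 2)"
    by (simp add: add_divide_distrib powr_add)
  show ?thesis unfolding normal_abs_moment_def 1 2 by simp
qed

lemma normal_abs_moment_0: "normal_abs_moment 0 = 1"
  by (simp add: normal_abs_moment_def Gamma_one_half_real)

lemma normal_abs_moment_1: "normal_abs_moment 1 = sqrt (2 / pi)"
  by (simp add: normal_abs_moment_def powr_half_sqrt real_sqrt_divide)

lemma normal_abs_moment_even: "normal_abs_moment (2 * k) = fact (2 * k) / (2 ^ k * fact k)"
proof (induction k)
  case (Suc k)
  have "normal_abs_moment (2 * Suc k) = (2 * real k + 1) * (fact (2 * k) / (2 ^ k * fact k))"
    using normal_abs_moment_rec[of "2 * k"] Suc by simp
  also have "\<dots> = fact (2 * Suc k) / (2 ^ Suc k * fact (Suc k))"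
  proof -
    have "(fact (2 * Suc k) :: real) = (2 * (real k + 1)) * ((2 * real k + 1) * fact (2 * k))"
      by (simp add: algebra_simps)
    moreover have "(2 ^ Suc k * fact (Suc k) :: real) = (2 * (real k + 1)) * (2 ^ k * fact k)"
      by (simp add: algebra_simps)
    moreover have "2 * (real k + 1) \<noteq> 0" by simp
    ultimately show ?thesis
      by (simp only: mult_divide_mult_cancel_left_if if_False times_divide_eq_right)
  qed
  finally show ?case .
qed (simp add: normal_abs_moment_0)

lemma normal_abs_moment_odd: "normal_abs_moment (2 * k + 1) = sqrt (2 / pi) * 2 ^ k * fact k"
proof (induction k)
  case (Suc k)
  then show ?case
    using normal_abs_moment_rec[of "2 * k + 1"] by (simp add: algebra_simps)
qed (simp add: normal_abs_moment_1[simplified])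

lemma nn_integral_gauss_abs_power:
  "(\<integral>\<^sup>+(y::real). ennreal (\<bar>y\<bar> ^ n) \<partial>gauss) = ennreal (normal_abs_moment n)"
proof -
  have "has_bochner_integral lborel (\<lambda>x. std_normal_density x * \<bar>x\<bar> ^ n) (normal_abs_moment n)"
  proof (cases "even n")
    case True
    then obtain k where "n = 2 * k" by blast
    then show ?thesis
      using std_normal_moment_even[of k] by (simp add: normal_abs_moment_even power_even_abs)
  next
    case False
    then obtain k where k: "n = 2 * k + 1" by (elim oddE)
    show ?thesis
      unfolding k normal_abs_moment_odd by (rule std_normal_moment_abs_odd)
  qed
  then have "(\<integral>\<^sup>+x. ennreal (std_normal_density x * \<bar>x\<bar> ^ n) \<partial>lborel) = ennreal (normal_abs_moment n)"
    by (subst nn_integral_eq_integral)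
       (auto simp: has_bochner_integral_iff)
  then show ?thesis by (simp add: gauss_real nn_integral_density ennreal_mult')
qed

lemma nn_integral_gauss_inner_power:
  fixes v :: "'a::euclidean_space"
  shows "(\<integral>\<^sup>+x. ennreal (\<bar>x \<bullet> v\<bar> ^ n) \<partial>gauss) = ennreal (norm v ^ n * normal_abs_moment n)"
proof (cases "v = 0")
  case True
  then show ?thesis
    using gauss.emeasure_space_1 by (cases n) (simp_all add: normal_abs_moment_0)
next
  case False
  have "(\<integral>\<^sup>+x. ennreal (\<bar>x \<bullet> v\<bar> ^ n) \<partial>gauss) =
      (\<integral>\<^sup>+x. ennreal (norm v ^ n) * ennreal (\<bar>x \<bullet> sgn v\<bar> ^ n) \<partial>gauss)"
    using False
    by (simp add: ennreal_mult'[symmetric] power_mult_distrib[symmetric] sgn_div_norm abs_mult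
        mult.assoc[symmetric])
  also have "\<dots> = ennreal (norm v ^ n) * ennreal (normal_abs_moment n)"
    using False nn_integral_gauss_inner[of "sgn v" "\<lambda>y. ennreal (\<bar>y\<bar> ^ n)"]
    by (subst nn_integral_cmult) (auto simp: norm_sgn nn_integral_gauss_abs_power)
  finally show ?thesis by (simp add: ennreal_mult')
qed

text \<open>Euler's integral after the substitution \<open>c * t\<close>. Read from right to left,
  it turns a negative power into a mixture of exponentials.\<close>

lemma nn_integral_Gamma_scaled:
  fixes a c :: real
  assumes a: "a > 0" and c: "c > 0"
  shows "(\<integral>\<^sup>+t. ennreal (indicator {0..} t * t powr (a - 1) * exp (- c * t)) \<partial>lborel) =
    ennreal (Gamma a * c powr (- a))"
proof -
  have "ennreal (Gamma a) = (\<integral>\<^sup>+t. ennreal (indicator {0..} t * t powr (a - 1) / exp t) \<partial>lborel)"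
    using Gamma_conv_nn_integral_real[OF a] .
  also have "\<dots> = ennreal c * (\<integral>\<^sup>+t. ennreal (indicator {0..} (c * t) * (c * t) powr (a - 1) / exp (c * t)) \<partial>lborel)"
    using c by (subst nn_integral_real_affine[where c=c and t=0]) auto
  also have "\<dots> = ennreal c * (\<integral>\<^sup>+t. ennreal (c powr (a - 1)) * ennreal (indicator {0..} t * t powr (a - 1) * exp (- c * t)) \<partial>lborel)"
    using c
    by (intro arg_cong[where f="\<lambda>x. ennreal c * x"] nn_integral_cong)
       (auto simp: indicator_def ennreal_mult'[symmetric] powr_mult zero_le_mult_iff exp_minus divide_simps)
  also have "\<dots> = ennreal (c powr a) * (\<integral>\<^sup>+t. ennreal (indicator {0..} t * t powr (a - 1) * exp (- c * t)) \<partial>lborel)"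
    using c by (subst nn_integral_cmult) (auto simp: mult.assoc[symmetric] ennreal_mult'[symmetric] powr_diff)
  finally have "ennreal (c powr (- a)) * ennreal (Gamma a) = ennreal (c powr (- a)) * (ennreal (c powr a) *
      (\<integral>\<^sup>+t. ennreal (indicator {0..} t * t powr (a - 1) * exp (- c * t)) \<partial>lborel))"
    by simp
  also have "\<dots> = (\<integral>\<^sup>+t. ennreal (indicator {0..} t * t powr (a - 1) * exp (- c * t)) \<partial>lborel)"
    using c unfolding mult.assoc[symmetric] by (simp add: ennreal_mult'[symmetric] powr_minus)
  finally show ?thesis
    unfolding mult.commute[of "Gamma a"] by (subst ennreal_mult') simp_all
qed

text \<open>The factor on the left is infinite for \<open>u = 0\<close>, as is the integral because of \<open>d \<ge> 2\<close>.\<close>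

lemma inverse_power_le_laplace:
  fixes u :: real
  assumes u: "u \<ge> 0" and d: "d \<ge> 2"
  shows "ennreal (Gamma (real d / 2)) * inverse (ennreal (sqrt u)) ^ d \<le>
    (\<integral>\<^sup>+t. ennreal (indicator {0..} t * t powr (real d / 2 - 1) * exp (- u * t)) \<partial>lborel)"
proof (cases "u = 0")
  case True
  have "(\<top>::ennreal) = emeasure lborel ({1..} :: real set)"
  proof (rule sym, rule ccontr)
    assume "emeasure lborel ({1..} :: real set) \<noteq> \<top>"
    then obtain m where m: "emeasure lborel ({1..} :: real set) = ennreal m" "m \<ge> 0"
      by (cases "emeasure lborel ({1..} :: real set)") auto
    have "emeasure lborel {1..m + 2} \<le> emeasure lborel ({1..} :: real set)"
      by (rule emeasure_mono) auto
    then show False using m by simp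
  qed
  also have "\<dots> = (\<integral>\<^sup>+(t::real). indicator {1..} t \<partial>lborel)"
    by (rule nn_integral_indicator[symmetric]) simp
  also have "\<dots> \<le> (\<integral>\<^sup>+t. ennreal (indicator {0..} t * t powr (real d / 2 - 1) * exp (- u * t)) \<partial>lborel)"
    using d True by (intro nn_integral_mono) (auto simp: indicator_def ge_one_powr_ge_zero)
  finally show ?thesis by (simp add: top_unique)
next
  case False
  then have u: "u > 0" using u by simp
  have "inverse (ennreal (sqrt u)) ^ d = ennreal ((1 / sqrt u) ^ d)"
    using u by (simp add: inverse_ennreal ennreal_power divide_inverse)
  also have "(1 / sqrt u) ^ d = u powr (- (real d / 2))"
  proof -
    have "sqrt u ^ d = (u powr (1 / 2)) powr real d"
      using u by (simp add: powr_half_sqrt powr_realpow)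
    also have "\<dots> = u powr (real d / 2)"
      by (simp add: powr_powr)
    finally show ?thesis by (simp add: powr_minus power_one_over inverse_eq_divide)
  qed
  finally show ?thesis
    using nn_integral_Gamma_scaled[of "real d / 2" u] u d
    by (simp add: ennreal_mult'[symmetric])
qed

text \<open>The inverse power is written as a Laplace integral, and Fubini leaves the known mean of
  \<open>exp (- t * u)\<close>. The remaining Beta integral is evaluated by writing its second
  factor as a Laplace integral too.\<close>

lemma nn_integral_gauss_inverse_power:
  fixes S :: "'a::euclidean_space set"
  assumes S: "finite S" "pairwise orthogonal S" "\<And>h. h \<in> S \<Longrightarrow> norm h = 1"
    and card: "card S = d + 1" and d: "d \<ge> 2"
  shows "(\<integral>\<^sup>+x. inverse (ennreal (sqrt (\<Sum>h\<in>S. (x \<bullet> h)\<^sup>2))) ^ d \<partial>gauss) \<le> ennreal (1 / normal_abs_moment d)"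
    (is "?A \<le> _")
proof -
  \<comment> \<open>With \<open>d + 1\<close> directions the transform has exponent
    \<open>- (s + 1 / 2)\<close>, which exceeds the exponent \<open>s\<close> of the Laplace weight
    by the half that makes the integral converge.\<close>
  define s where "s = real d / 2"
  have s: "s \<ge> 1" using d by (simp add: s_def)
  have pos: "Gamma s > 0" "Gamma (s + 1 / 2) > 0" using s by (auto intro!: Gamma_real_pos)
  let ?u = "\<lambda>x::'a. \<Sum>h\<in>S. (x \<bullet> h)\<^sup>2"
  define w where "w = (\<lambda>a t::real. indicator {0..} t * t powr (a - 1))"
  have w[measurable]: "w a \<in> borel_measurable borel" for a by (simp add: w_def)
  have w0: "w a t \<ge> 0" for a t by (simp add: w_def)
  have G: "(\<integral>\<^sup>+t. ennreal (w a t * exp (- c * t)) \<partial>lborel) = ennreal (Gamma a * c powr (- a))"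
    if "a > 0" "c > 0" for a c
    using nn_integral_Gamma_scaled[OF that] by (simp add: w_def)
  have "ennreal (Gamma s) * ?A = (\<integral>\<^sup>+x. ennreal (Gamma s) * inverse (ennreal (sqrt (?u x))) ^ d \<partial>gauss)"
    by (simp add: nn_integral_cmult)
  also have "\<dots> \<le> (\<integral>\<^sup>+x. \<integral>\<^sup>+t. ennreal (w s t * exp (- ?u x * t)) \<partial>lborel \<partial>gauss)"
    unfolding s_def w_def
    by (rule nn_integral_mono, rule inverse_power_le_laplace, simp_all add: sum_nonneg d)
  also have "\<dots> = (\<integral>\<^sup>+t. \<integral>\<^sup>+x. ennreal (w s t * exp (- ?u x * t)) \<partial>gauss \<partial>lborel)"
    by (rule pair_sigma_finite.Fubini'[symmetric])
       (simp_all add: pair_sigma_finite_def lborel.sigma_finite_measure_axioms gauss.sigma_finite_measure_axioms)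
  also have "\<dots> = (\<integral>\<^sup>+t. ennreal (w s t * (1 + 2 * t) powr (- (s + 1 / 2))) \<partial>lborel)"
  proof (rule nn_integral_cong)
    fix t :: real
    show "(\<integral>\<^sup>+x. ennreal (w s t * exp (- ?u x * t)) \<partial>gauss) = ennreal (w s t * (1 + 2 * t) powr (- (s + 1 / 2)))"
    proof (cases "t \<ge> 0")
      case True
      have "(\<integral>\<^sup>+x. ennreal (w s t * exp (- ?u x * t)) \<partial>gauss) =
          ennreal (w s t) * (\<integral>\<^sup>+x. ennreal (exp (- t * ?u x)) \<partial>gauss)"
        by (subst nn_integral_cmult[symmetric]) (simp_all add: ennreal_mult' w0 mult.commute)
      also have "\<dots> = ennreal (w s t) * ennreal ((1 + 2 * t) powr (- (s + 1 / 2)))"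
      proof -
        have "- real (card S) / 2 = - (s + 1 / 2)" by (simp add: s_def card field_simps)
        then show ?thesis
          using True nn_integral_gauss_exp_sum_squares[OF S, of t] by simp
      qed
      finally show ?thesis by (simp add: ennreal_mult' w0)
    qed (simp add: w_def)
  qed
  finally have 1: "ennreal (Gamma s) * ?A \<le> (\<integral>\<^sup>+t. ennreal (w s t * (1 + 2 * t) powr (- (s + 1 / 2))) \<partial>lborel)" .
  \<comment> \<open>Integrating over \<open>t\<close> first leaves \<open>y\<close> to the power
    \<open>- 1 / 2\<close>, so the last integral is \<open>Gamma (1 / 2) = sqrt pi\<close>.\<close>
  have "ennreal (Gamma (s + 1 / 2)) * (\<integral>\<^sup>+t. ennreal (w s t * (1 + 2 * t) powr (- (s + 1 / 2))) \<partial>lborel) =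
      (\<integral>\<^sup>+t. ennreal (w s t) * ennreal (Gamma (s + 1 / 2) * (1 + 2 * t) powr (- (s + 1 / 2))) \<partial>lborel)"
    by (subst nn_integral_cmult[symmetric], simp, rule nn_integral_cong)
       (use pos in \<open>simp only: ennreal_mult'[symmetric] w0 powr_ge_zero mult_nonneg_nonneg less_imp_le mult_ac\<close>)
  also have "\<dots> = (\<integral>\<^sup>+t. \<integral>\<^sup>+y. ennreal (w s t) * ennreal (w (s + 1 / 2) y * exp (- (1 + 2 * t) * y)) \<partial>lborel \<partial>lborel)"
  proof (rule nn_integral_cong)
    fix t :: real
    show "ennreal (w s t) * ennreal (Gamma (s + 1 / 2) * (1 + 2 * t) powr (- (s + 1 / 2))) =
      (\<integral>\<^sup>+y. ennreal (w s t) * ennreal (w (s + 1 / 2) y * exp (- (1 + 2 * t) * y)) \<partial>lborel)"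
    proof (cases "t \<ge> 0")
      case True
      then show ?thesis using s by (subst nn_integral_cmult) (simp_all only: G, simp_all)
    qed (simp add: w_def)
  qed
  also have "\<dots> = (\<integral>\<^sup>+y. \<integral>\<^sup>+t. ennreal (w s t) * ennreal (w (s + 1 / 2) y * exp (- (1 + 2 * t) * y)) \<partial>lborel \<partial>lborel)"
    by (intro lborel_pair.Fubini') simp
  also have "\<dots> = (\<integral>\<^sup>+y. ennreal (Gamma s * 2 powr (- s)) * ennreal (w (1 / 2) y * exp (- 1 * y)) \<partial>lborel)"
  proof (rule nn_integral_cong)
    fix y :: real
    show "(\<integral>\<^sup>+t. ennreal (w s t) * ennreal (w (s + 1 / 2) y * exp (- (1 + 2 * t) * y)) \<partial>lborel) =
      ennreal (Gamma s * 2 powr (- s)) * ennreal (w (1 / 2) y * exp (- 1 * y))"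
    proof (cases "y > 0")
      case True
      have wy: "w (s + 1 / 2) y * (2 * y) powr (- s) = 2 powr (- s) * w (1 / 2) y"
        using True by (simp add: w_def powr_mult powr_add[symmetric])
      have "(w (s + 1 / 2) y * exp (- y)) * (Gamma s * (2 * y) powr (- s)) =
          (w (s + 1 / 2) y * (2 * y) powr (- s)) * (Gamma s * exp (- y))"
        by (simp only: mult_ac)
      then have weq: "(w (s + 1 / 2) y * exp (- y)) * (Gamma s * (2 * y) powr (- s)) =
          (Gamma s * 2 powr (- s)) * (w (1 / 2) y * exp (- 1 * y))"
        unfolding wy by (simp only: mult_ac mult_minus1_right)
      have "(\<integral>\<^sup>+t. ennreal (w s t) * ennreal (w (s + 1 / 2) y * exp (- (1 + 2 * t) * y)) \<partial>lborel) =
        (\<integral>\<^sup>+t. ennreal (w (s + 1 / 2) y * exp (- y)) * ennreal (w s t * exp (- (2 * y) * t)) \<partial>lborel)"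
      proof (rule nn_integral_cong)
        fix t :: real
        have "exp (- (1 + 2 * t) * y) = exp (- y) * exp (- (2 * y) * t)"
          by (simp add: exp_add[symmetric] algebra_simps)
        then have "w s t * (w (s + 1 / 2) y * exp (- (1 + 2 * t) * y)) =
            (w (s + 1 / 2) y * exp (- y)) * (w s t * exp (- (2 * y) * t))"
          by simp
        then show "ennreal (w s t) * ennreal (w (s + 1 / 2) y * exp (- (1 + 2 * t) * y)) =
            ennreal (w (s + 1 / 2) y * exp (- y)) * ennreal (w s t * exp (- (2 * y) * t))"
          by (simp only: ennreal_mult'[symmetric] w0 mult_nonneg_nonneg exp_ge_zero)
      qed
      also have "\<dots> = ennreal (w (s + 1 / 2) y * exp (- y)) * ennreal (Gamma s * (2 * y) powr (- s))"
        using True s by (subst nn_integral_cmult) (simp_all only: G, simp_all)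
      also have "ennreal (w (s + 1 / 2) y * exp (- y)) * ennreal (Gamma s * (2 * y) powr (- s)) =
         ennreal (Gamma s * 2 powr (- s)) * ennreal (w (1 / 2) y * exp (- 1 * y))"
        using pos weq by (simp only: ennreal_mult'[symmetric] w0 mult_nonneg_nonneg exp_ge_zero
            powr_ge_zero less_imp_le)
      finally show ?thesis .
    next
      case False
      then have "w a y = 0" for a by (auto simp: w_def indicator_def)
      then show ?thesis by simp
    qed
  qed
  also have "\<dots> = ennreal (Gamma s * 2 powr (- s)) * ennreal (sqrt pi)"
    by (subst nn_integral_cmult) (simp_all only: G, simp_all add: Gamma_one_half_real)
  finally have 2: "ennreal (Gamma (s + 1 / 2)) *
      (\<integral>\<^sup>+t. ennreal (w s t * (1 + 2 * t) powr (- (s + 1 / 2))) \<partial>lborel) =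
      ennreal (Gamma s * 2 powr (- s)) * ennreal (sqrt pi)" .
  define K where "K = Gamma s * Gamma (s + 1 / 2)"
  have K: "K > 0" using pos by (simp add: K_def)
  have "ennreal K * ?A = ennreal (Gamma (s + 1 / 2)) * (ennreal (Gamma s) * ?A)"
    using pos by (simp only: K_def ennreal_mult' less_imp_le mult_ac)
  also have "\<dots> \<le> ennreal (Gamma s * 2 powr (- s)) * ennreal (sqrt pi)"
    unfolding 2[symmetric] by (intro mult_left_mono 1) simp
  also have "\<dots> = ennreal K * ennreal (1 / normal_abs_moment d)"
  proof -
    have n: "normal_abs_moment d = 2 powr s * Gamma (s + 1 / 2) / sqrt pi"
      by (simp add: normal_abs_moment_def s_def add_divide_distrib)
    have "K * (1 / normal_abs_moment d) = Gamma s * 2 powr (- s) * sqrt pi"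
      unfolding n K_def powr_minus using pos(2) by (simp add: divide_simps)
    then show ?thesis
      using pos(1) K by (simp only: ennreal_mult'[symmetric] mult_nonneg_nonneg powr_ge_zero less_imp_le)
  qed
  finally show ?thesis
    using K by (subst (asm) ennreal_mult_le_mult_iff) simp_all
qed

text \<open>Only an upper bound on \<open>card S\<close> is assumed, since a best approximation may
  have rank below \<open>k\<close>. In the application \<open>k + d\<close> is the number of columns
  of the random matrix.\<close>

lemma nn_integral_gauss_power_sum_squares_le:
  fixes S :: "'a::euclidean_space set"
  assumes S: "finite S" "pairwise orthogonal S" "\<And>h. h \<in> S \<Longrightarrow> norm h = 1"
    and card: "card S \<le> k" and k: "k \<ge> 1"
  shows "(\<integral>\<^sup>+x. ennreal (sqrt (\<Sum>h\<in>S. (x \<bullet> h)\<^sup>2) ^ d) \<partial>gauss) \<le> ennreal (sqrt (real (k + d)) ^ d)"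
proof -
  define q where "q = real (k + d)"
  have q: "q > 0" "q \<ge> real k" using k by (auto simp: q_def)
  \<comment> \<open>The bound \<open>u \<le> q * exp (u / q - 1)\<close> is tight at
    \<open>u = q\<close>; raised to the power \<open>d / 2\<close> it produces this exponent. Then
    \<open>1 + 2 * t = k / q\<close> is positive, so the exponential moment is finite.\<close>
  define t where "t = - real d / (2 * q)"
  have t1: "1 + 2 * t = real k / q" using q by (simp add: t_def q_def field_simps)
  have "1 + 2 * t > 0" using t1 k q by simp
  then have t: "t > - 1 / 2" by simp
  let ?u = "\<lambda>x::'a. \<Sum>h\<in>S. (x \<bullet> h)\<^sup>2"
  \<comment> \<open>A Chernoff bound loses nothing here: the factor \<open>(q / k) powr (k / 2)\<close> that it produces is at
    most \<open>exp (d / 2)\<close>, which is what the bound on the power gained.\<close>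
  have bound: "sqrt u ^ d \<le> sqrt (q / exp 1) ^ d * exp (- t * u)" if "u \<ge> 0" for u
  proof -
    have "u = q * (u / q)" using q by simp
    also have "\<dots> \<le> q * exp (u / q - 1)"
      using exp_ge_add_one_self[of "u / q - 1"] q by (intro mult_left_mono) auto
    also have "\<dots> = (q / exp 1) * exp (u / q)" by (simp add: exp_diff)
    also have "exp (u / q) = (exp (u / (2 * q)))\<^sup>2"
      by (simp add: power2_eq_square exp_add[symmetric])
    finally have "u \<le> q / exp 1 * (exp (u / (2 * q)))\<^sup>2" .
    then have "sqrt u \<le> sqrt (q / exp 1 * (exp (u / (2 * q)))\<^sup>2)"
      by (rule real_sqrt_le_mono)
    then have "sqrt u \<le> sqrt (q / exp 1) * exp (u / (2 * q))"
      by (simp only: real_sqrt_mult real_sqrt_abs abs_exp_cancel)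
    then have "sqrt u ^ d \<le> (sqrt (q / exp 1) * exp (u / (2 * q))) ^ d"
      using that by (intro power_mono) auto
    also have "\<dots> = sqrt (q / exp 1) ^ d * exp (real d * (u / (2 * q)))"
      by (simp only: power_mult_distrib exp_of_nat_mult)
    finally show ?thesis by (simp add: t_def)
  qed
  have "(\<integral>\<^sup>+x. ennreal (sqrt (?u x) ^ d) \<partial>gauss) \<le>
     (\<integral>\<^sup>+x. ennreal (sqrt (q / exp 1) ^ d) * ennreal (exp (- t * ?u x)) \<partial>gauss)"
    using q bound by (intro nn_integral_mono) (simp add: ennreal_mult'[symmetric] sum_nonneg)
  also have "\<dots> = ennreal (sqrt (q / exp 1) ^ d * (1 + 2 * t) powr (- real (card S) / 2))"
    using q
    by (subst nn_integral_cmult, simp, subst nn_integral_gauss_exp_sum_squares[OF S t])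
       (auto intro!: ennreal_mult[symmetric])
  also have "\<dots> \<le> ennreal (sqrt q ^ d)"
  proof (rule ennreal_leI)
    have "(1 + 2 * t) powr (- real (card S) / 2) = inverse ((real k / q) powr (real (card S) / 2))"
      unfolding t1 by (simp only: powr_minus minus_divide_left[symmetric])
    also have "\<dots> = (q / real k) powr (real (card S) / 2)"
      using q k by (simp add: powr_divide)
    also have "\<dots> \<le> (q / real k) powr (real k / 2)"
      using q k card by (intro powr_mono) auto
    also have "\<dots> = (1 + real d / real k) powr (real k / 2)"
      using k by (simp add: q_def add_divide_distrib)
    also have "\<dots> \<le> exp (real d / real k) powr (real k / 2)"
      by (intro powr_mono2) (auto intro: exp_ge_add_one_self)
    also have "\<dots> = exp (1/2) ^ d"
    proof -
      have "exp (real d / real k) powr (real k / 2) = exp (real d * (1 / 2))"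
        using k by (simp add: powr_def)
      then show ?thesis by (simp only: exp_of_nat_mult)
    qed
    also have "exp (1/2) = sqrt (exp 1 :: real)"
    proof (rule real_sqrt_unique[symmetric])
      show "(exp (1 / 2 :: real))\<^sup>2 = exp 1"
        unfolding power2_eq_square exp_add[symmetric] by simp
    qed simp
    finally have "(1 + 2 * t) powr (- real (card S) / 2) \<le> sqrt (exp 1) ^ d" .
    then have "sqrt (q / exp 1) ^ d * (1 + 2 * t) powr (- real (card S) / 2) \<le>
        sqrt (q / exp 1) ^ d * sqrt (exp 1) ^ d"
      by (rule mult_left_mono) (use q in simp)
    also have "sqrt (q / exp 1) ^ d * sqrt (exp 1) ^ d = sqrt (q / exp 1 * exp 1) ^ d"
      by (simp only: power_mult_distrib real_sqrt_mult)
    finally show "sqrt (q / exp 1) ^ d * (1 + 2 * t) powr (- real (card S) / 2) \<le> sqrt q ^ d"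
      by simp
  qed
  finally show ?thesis by (simp add: q_def)
qed

section \<open>Lower bound for the normal absolute moments\<close>

text \<open>The difference of the two sides vanishes at \<open>0\<close> and has derivative
  \<open>- ln (1 - t * t) \<ge> 0\<close>.\<close>

lemma entropy_difference_le:
  fixes t :: real
  assumes "0 \<le> t" "t < 1"
  shows "(1 + t) * ln (1 + t) - (1 - t) * ln (1 - t) \<le> 2 * t"
proof -
  define g where "g = (\<lambda>t::real. 2 * t - ((1 + t) * ln (1 + t) - (1 - t) * ln (1 - t)))"
  have "g 0 \<le> g t"
  proof (rule DERIV_nonneg_imp_nondecreasing[OF assms(1)])
    fix x assume x: "0 \<le> x" "x \<le> t"
    then have x1: "x < 1" using assms by simp
    have "(g has_real_derivative - (ln (1 + x) + ln (1 - x))) (at x)"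
      unfolding g_def using x x1
      by (auto intro!: derivative_eq_intros)
    moreover have "ln (1 + x) + ln (1 - x) = ln ((1 + x) * (1 - x))"
      using x x1 by (intro ln_mult_pos[symmetric]) auto
    moreover have "(1 + x) * (1 - x) \<le> 1" by (simp add: algebra_simps)
    then have "ln ((1 + x) * (1 - x)) \<le> 0" using x x1 by (subst ln_le_zero_iff) auto
    ultimately show "\<exists>y. (g has_real_derivative y) (at x) \<and> 0 \<le> y" by auto
  qed
  then show ?thesis by (simp add: g_def)
qed

text \<open>This is the entropy inequality at \<open>t = 1 / (n + 1)\<close>, multiplied by
  \<open>n + 1\<close> and exponentiated. It says that \<open>(n / e) ^ n\<close> grows in two steps
  by at most \<open>(n + 1)\<^sup>2\<close>, the growth of the squared moment.\<close>

lemma power_self_step_le: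
  fixes n :: nat
  assumes n: "n \<ge> 1"
  shows "(real n + 2) ^ (n + 2) \<le> exp 2 * (real n + 1)\<^sup>2 * real n ^ n"
proof -
  define t where "t = 1 / (real n + 1)"
  have t: "0 \<le> t" "t < 1" using n by (auto simp: t_def)
  have "1 + t = (real n + 2) / (real n + 1)" "1 - t = real n / (real n + 1)"
    by (auto simp: t_def field_simps)
  then have "(real n + 2) / (real n + 1) * (ln (real n + 2) - ln (real n + 1)) -
       real n / (real n + 1) * (ln (real n) - ln (real n + 1)) \<le> 2 / (real n + 1)"
    using entropy_difference_le[OF t] n by (simp add: t_def ln_div)
  then have "(real n + 1) * ((real n + 2) / (real n + 1) * (ln (real n + 2) - ln (real n + 1)) -
       real n / (real n + 1) * (ln (real n) - ln (real n + 1))) \<le> (real n + 1) * (2 / (real n + 1))"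
    by (intro mult_left_mono) auto
  also have "(real n + 1) * ((real n + 2) / (real n + 1) * (ln (real n + 2) - ln (real n + 1)) -
       real n / (real n + 1) * (ln (real n) - ln (real n + 1))) =
       (real n + 2) * (ln (real n + 2) - ln (real n + 1)) - real n * (ln (real n) - ln (real n + 1))"
    by (simp add: right_diff_distrib)
  also have "(real n + 1) * (2 / (real n + 1)) = 2"
    by (rule nonzero_mult_div_cancel_left[of "real n + 1" 2, simplified times_divide_eq_right[symmetric]]) simp
  finally have "(real n + 2) * ln (real n + 2) \<le> 2 + 2 * ln (real n + 1) + real n * ln (real n)"
    by (simp add: algebra_simps)
  then have "exp ((real n + 2) * ln (real n + 2)) \<le> exp (2 + 2 * ln (real n + 1) + real n * ln (real n))"
    by simp
  also have "\<dots> = exp 2 * (real n + 1) powr real 2 * real n powr real n"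
    using n by (simp add: exp_add powr_def mult_ac)
  also have "\<dots> = exp 2 * (real n + 1)\<^sup>2 * real n ^ n"
    using n by (subst (1 2) powr_realpow) auto
  also have "exp ((real n + 2) * ln (real n + 2)) = (real n + 2) powr real (n + 2)"
    using n by (simp add: powr_def)
  also have "\<dots> = (real n + 2) ^ (n + 2)" by (rule powr_realpow) simp
  finally show ?thesis .
qed

lemma normal_abs_moment_ge: "(real n / exp 1) ^ n \<le> (normal_abs_moment n)\<^sup>2"
proof (induction n rule: induct_nat_012)
  case 0
  then show ?case by (simp add: normal_abs_moment_0)
next
  case 1
  have "pi \<le> 2 * exp 1" using pi_less_4 exp_ge_add_one_self[of 1] by simp
  then have "1 / exp 1 \<le> 2 / pi" by (simp add: field_simps)
  then show ?case using normal_abs_moment_1 by simp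
next
  case (ge2 n)
  have rec: "(normal_abs_moment (Suc (Suc n)))\<^sup>2 = (real n + 1)\<^sup>2 * (normal_abs_moment n)\<^sup>2"
    using normal_abs_moment_rec[of n] by (simp add: power_mult_distrib)
  show ?case
  proof (cases "n = 0")
    \<comment> \<open>At \<open>n = 0\<close> the step lemma does not apply; the claim for
      \<open>2\<close> is just \<open>(2 / e)\<^sup>2 \<le> 1\<close>.\<close>
    case True
    have "2 \<le> exp (1::real)" using exp_ge_add_one_self[of 1] by simp
    then have "(2 / exp 1) ^ 2 \<le> (1::real)" by (intro power_le_one) auto
    then show ?thesis using True rec by (simp add: normal_abs_moment_0 numeral_2_eq_2)
  next
    case False
    then have "(real n + 2) ^ (n + 2) / exp 1 ^ (n + 2) \<le>
        exp 2 * (real n + 1)\<^sup>2 * real n ^ n / exp 1 ^ (n + 2)"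
      using power_self_step_le[of n] by (intro divide_right_mono) auto
    also have "\<dots> = (real n + 1)\<^sup>2 * (real n / exp 1) ^ n"
    proof -
      have "exp 2 = exp (1::real) ^ 2" using exp_of_nat_mult[of 2 "1::real"] by simp
      then show ?thesis by (simp add: power_add power_divide power2_eq_square)
    qed
    also have "\<dots> \<le> (real n + 1)\<^sup>2 * (normal_abs_moment n)\<^sup>2"
      using ge2 by (intro mult_left_mono) auto
    finally show ?thesis by (simp add: rec power_divide add.commute)
  qed
qed

text \<open>The tangent at \<open>1\<close> to the concave function \<open>z powr (2 / d)\<close>,
  with \<open>z = y ^ d\<close>. It replaces Jensen's inequality when passing from
  \<open>d\<close>-th to second moments. In the induction step, the sign of \<open>y - 1\<close>
  decides how \<open>y + 1\<close> compares with \<open>2 * y ^ n\<close>.\<close>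

lemma square_le_power_tangent:
  fixes y :: real
  assumes y: "y \<ge> 0" and d: "d \<ge> 2"
  shows "real d * y\<^sup>2 \<le> 2 * y ^ d + real d - 2"
  using d
proof (induction d rule: dec_induct)
  case (step n)
  have "(y - 1) * (y + 1) \<le> (y - 1) * (2 * y ^ n)"
  proof (cases "y \<ge> 1")
    case True
    then have "y \<le> y ^ n" "1 \<le> y ^ n" using step.hyps by (auto simp: self_le_power)
    then show ?thesis using True by (intro mult_left_mono) auto
  next
    case False
    then have "y ^ n \<le> y ^ 1" using y step.hyps by (intro power_decreasing) auto
    then show ?thesis using False y by (intro mult_left_mono_neg) auto
  qed
  then show ?case using step.IH by (simp add: algebra_simps power2_eq_square)
qed simp

section \<open>Orthonormal sets\<close>

text \<open>The size \<open>n\<close> is prescribed, so the same number of directions is available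
  even when \<open>H\<close> has smaller dimension than expected.\<close>

lemma exists_orthonormal_complement:
  fixes H :: "'a::euclidean_space set"
  assumes H: "subspace H" and n: "dim H + n \<le> DIM('a)"
  obtains E where "finite E" "pairwise orthogonal E" "\<And>e. e \<in> E \<Longrightarrow> norm e = 1" "card E = n"
    "\<And>e h. e \<in> E \<Longrightarrow> h \<in> H \<Longrightarrow> h \<bullet> e = 0"
proof -
  define N where "N = {y. \<forall>x\<in>H. orthogonal x y}"
  have "subspace N"
    unfolding N_def by (auto simp: subspace_def orthogonal_def inner_add_right)
  moreover have "dim N + dim H = DIM('a)"
    using dim_subspace_orthogonal_to_vectors[OF H subspace_UNIV] by (simp add: N_def)
  ultimately obtain S where S: "S \<subseteq> N" "pairwise orthogonal S" "\<And>x. x \<in> S \<Longrightarrow> norm x = 1"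
      "independent S" "card S = dim N"
    by (metis orthonormal_basis_subspace)
  have "finite S" using S independent_imp_finite by blast
  moreover have "n \<le> card S" using S(5) \<open>dim N + dim H = DIM('a)\<close> n by simp
  ultimately obtain E where E: "E \<subseteq> S" "card E = n" "finite E"
    by (metis obtain_subset_with_card_n)
  show thesis
  proof (rule that[of E])
    show "pairwise orthogonal E" using S(2) E(1) by (rule pairwise_subset)
    show "h \<bullet> e = 0" if "e \<in> E" "h \<in> H" for e h
      using that S(1) E(1) by (auto simp: N_def orthogonal_def)
  qed (use S E in auto)
qed

lemma norm_sum_orthonormal:
  fixes E :: "'a::euclidean_space set"
  assumes "finite E" "pairwise orthogonal E" "\<And>e. e \<in> E \<Longrightarrow> norm e = 1"
  shows "norm (\<Sum>e\<in>E. c e *\<^sub>R e) = sqrt (\<Sum>e\<in>E. (c e)\<^sup>2)"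
proof -
  have "(norm (\<Sum>e\<in>E. c e *\<^sub>R e))\<^sup>2 = (\<Sum>e\<in>E. (norm (c e *\<^sub>R e))\<^sup>2)"
    using assms by (intro norm_sum_Pythagorean) (auto simp: pairwise_def orthogonal_def)
  also have "\<dots> = (\<Sum>e\<in>E. (c e)\<^sup>2)" using assms(3) by simp
  finally show ?thesis by (metis norm_ge_zero real_sqrt_unique)
qed

text \<open>For a finite orthonormal \<open>S\<close> this is the orthogonal projection to
  \<open>span S\<close>.\<close>

definition onproj :: "'a::euclidean_space set \<Rightarrow> 'a \<Rightarrow> 'a" where
  "onproj S x = (\<Sum>b\<in>S. (x \<bullet> b) *\<^sub>R b)"

lemma onproj_linear: "linear (onproj S)"
  by (rule linearI) (auto simp: onproj_def inner_add_left sum.distrib scaleR_add_left scaleR_sum_right)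

lemma onproj_in_span: "onproj S x \<in> span S"
  unfolding onproj_def by (auto intro: span_sum span_scale span_base)

lemma onproj_inner_commute: "onproj S x \<bullet> y = x \<bullet> onproj S y"
  by (simp add: onproj_def inner_sum_left inner_sum_right inner_commute mult.commute)

locale orthonormal_set =
  fixes S :: "'a::euclidean_space set"
  assumes fin: "finite S" and orth: "pairwise orthogonal S" and unit: "\<And>e. e \<in> S \<Longrightarrow> norm e = 1"
begin

lemma norm_onproj: "norm (onproj S x) = sqrt (\<Sum>e\<in>S. (x \<bullet> e)\<^sup>2)"
  unfolding onproj_def using fin orth unit by (rule norm_sum_orthonormal)

lemma onproj_base: "b \<in> S \<Longrightarrow> onproj S b = b"
proof -
  assume b: "b \<in> S"
  have "onproj S b = (\<Sum>e\<in>S. if e = b then b else 0)"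
    unfolding onproj_def
  proof (rule sum.cong)
    fix e assume "e \<in> S"
    then show "(b \<bullet> e) *\<^sub>R e = (if e = b then b else 0)"
      using pairwiseD[OF orth b \<open>e \<in> S\<close>] norm_eq_1[THEN iffD1, OF unit[OF b]]
      by (cases "e = b") (simp_all add: orthogonal_def)
  qed simp
  then show ?thesis using fin b by simp
qed

lemma onproj_span: "x \<in> span S \<Longrightarrow> onproj S x = x"
proof (induction rule: span_induct_alt)
  case base
  then show ?case by (rule linear_0[OF onproj_linear])
next
  case (step c x y)
  then show ?case
    by (simp only: linear_add[OF onproj_linear] linear_scale[OF onproj_linear] onproj_base)
qed

lemma onproj_idem: "onproj S (onproj S x) = onproj S x"
  by (rule onproj_span[OF onproj_in_span])

lemma norm_diff_onproj_le:
  assumes "y \<in> span S"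
  shows "norm (x - onproj S x) \<le> norm (x - y)"
proof -
  have "onproj S (onproj S x - y) = onproj S x - y"
    by (rule onproj_span) (intro span_diff onproj_in_span assms)
  then have "(x - onproj S x) \<bullet> (onproj S x - y) = 0"
    using onproj_inner_commute[of S x "onproj S x - y"] unfolding inner_diff_left by simp
  then have "(norm ((x - onproj S x) + (onproj S x - y)))\<^sup>2 =
      (norm (x - onproj S x))\<^sup>2 + (norm (onproj S x - y))\<^sup>2"
    by (intro norm_add_Pythagorean) (simp add: orthogonal_def)
  then have "(norm (x - onproj S x))\<^sup>2 \<le> (norm (x - y))\<^sup>2" by simp
  then show ?thesis by (rule power2_le_imp_le) simp
qed

lemma norm_onproj_le: "norm (onproj S x) \<le> norm x"
proof -
  have "(norm (onproj S x))\<^sup>2 = x \<bullet> onproj S x"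
    unfolding power2_norm_eq_inner onproj_inner_commute[of S x] onproj_idem ..
  also have "\<dots> \<le> norm x * norm (onproj S x)" by (rule norm_cauchy_schwarz)
  finally show ?thesis
    unfolding power2_eq_square by (cases "onproj S x = 0") simp_all
qed

end

section \<open>Gaussian matrices\<close>

text \<open>Transfers the problem from the abstract probability space to \<open>gauss\<close>.
  Independence determines the joint law of the entries as a product measure; \<open>C\<close>
  flattens a matrix into its family of entries and \<open>R\<close> restores it.\<close>

lemma std_gaussian_matrix_distr:
  fixes \<Omega> :: "'a \<Rightarrow> real ^ 'q ^ 'p"
  assumes "prob_space M" and \<Omega>: "std_gaussian_matrix M \<Omega>"
  shows "\<Omega> \<in> borel_measurable M" and "distr M borel \<Omega> = gauss"
proof -
  interpret prob_space M by fact
  define X where "X = (\<lambda>ij \<omega>. \<Omega> \<omega> $ fst ij $ snd ij)"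
  define C where "C = (\<lambda>x::real ^ 'q ^ 'p. \<lambda>ij\<in>UNIV. x $ fst ij $ snd ij)"
  define R where "R = (\<lambda>f. \<chi> i j. f (i, j) :: real ^ 'q ^ 'p)"
  let ?N = "density lborel std_normal_density"
  have indep: "indep_vars (\<lambda>_. borel) X UNIV"
    and dist: "distributed M lborel (X ij) std_normal_density" for ij
    using \<Omega> by (auto simp: std_gaussian_matrix_def X_def split_beta')
  have rv[measurable]: "X ij \<in> borel_measurable M" for ij
    using distributed_measurable[OF dist[of ij]] by simp
  have XC: "(\<lambda>\<omega>. \<lambda>ij\<in>UNIV. X ij \<omega>) = (\<lambda>\<omega>. C (\<Omega> \<omega>))"
    by (simp add: X_def C_def)
  have "(\<lambda>\<omega>. \<chi> i j. X (i, j) \<omega>) \<in> borel_measurable M"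
    by (subst borel_measurable_euclidean_space)
       (auto simp: Basis_vec_def inner_axis)
  then show meas[measurable]: "\<Omega> \<in> borel_measurable M"
    by (simp add: X_def)
  have C[measurable]: "C \<in> borel \<rightarrow>\<^sub>M (\<Pi>\<^sub>M ij\<in>UNIV. borel)"
    unfolding C_def
    by (intro measurable_restrict borel_measurable_continuous_onI) (auto intro!: continuous_intros)
  have R[measurable]: "R \<in> (\<Pi>\<^sub>M ij\<in>UNIV. borel) \<rightarrow>\<^sub>M borel"
    unfolding R_def
    by (subst borel_measurable_euclidean_space) (auto simp: Basis_vec_def inner_axis)
  have RC: "R (C x) = x" for x by (simp add: R_def C_def)
  have "distr M (\<Pi>\<^sub>M ij\<in>UNIV. borel) (\<lambda>\<omega>. C (\<Omega> \<omega>)) = (\<Pi>\<^sub>M ij\<in>UNIV. distr M borel (X ij))"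
    using indep_vars_iff_distr_eq_PiM[where I=UNIV and M'="\<lambda>_. borel" and X=X] indep rv by (simp add: XC)
  also have "\<dots> = (\<Pi>\<^sub>M (ij :: 'p \<times> 'q)\<in>UNIV. ?N)"
  proof (rule PiM_cong)
    fix ij
    have "distr M borel (X ij) = distr M lborel (X ij)" by (rule distr_cong) auto
    then show "distr M borel (X ij) = ?N"
      using distributed_distr_eq_density[OF dist[of ij]] by simp
  qed simp
  \<comment> \<open>It is enough to compare the laws on boxes, where the Gaussian side factors over
    the standard basis; \<open>e\<close> indexes that basis by pairs.\<close>
  also have "\<dots> = distr gauss (\<Pi>\<^sub>M ij\<in>UNIV. borel) C"
  proof (rule sym, rule product_sigma_finite.PiM_eqI)
    show "sets (distr gauss (\<Pi>\<^sub>M ij\<in>UNIV. borel) C) = sets (\<Pi>\<^sub>M ij\<in>UNIV. ?N)"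
      by (simp cong: sets_PiM_cong)
    fix A :: "'p \<times> 'q \<Rightarrow> real set" assume A: "\<And>ij. ij \<in> UNIV \<Longrightarrow> A ij \<in> sets ?N"
    have A'[measurable]: "A ij \<in> sets borel" for ij using A by simp
    define e where "e = (\<lambda>ij :: 'p \<times> 'q. axis (fst ij) (axis (snd ij) 1) :: real ^ 'q ^ 'p)"
    have e_inj: "inj e"
      by (auto simp: e_def inj_on_def axis_eq_axis)
    have e_range: "range e = Basis"
    proof -
      have "(Basis :: (real ^ 'q ^ 'p) set) = (\<Union>i. \<Union>j. {axis i (axis j 1)})"
        by (simp add: Basis_vec_def)
      also have "\<dots> = (\<Union>ij. {e ij})" by (auto simp: e_def) blast
      finally show ?thesis by auto
    qed
    have xe: "x \<bullet> e ij = x $ fst ij $ snd ij" for x ij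
      by (simp add: e_def inner_axis)
    define A2 where "A2 = (\<lambda>b. A (inv e b))"
    have "emeasure (distr gauss (\<Pi>\<^sub>M ij\<in>UNIV. borel) C) (Pi\<^sub>E UNIV A) =
        emeasure gauss (C -` Pi\<^sub>E UNIV A)"
      by (subst emeasure_distr) (auto intro!: sets_PiM_I_finite)
    also have "\<dots> = (\<integral>\<^sup>+x. indicator (C -` Pi\<^sub>E UNIV A) x \<partial>gauss)"
      by (rule nn_integral_indicator[symmetric])
         (auto intro!: measurable_sets_borel[OF C] sets_PiM_I_finite)
    also have "\<dots> = (\<integral>\<^sup>+x. (\<Prod>b\<in>Basis. indicator (A2 b) (x \<bullet> b)) \<partial>gauss)"
    proof (rule nn_integral_cong)
      fix x :: "real ^ 'q ^ 'p"
      have "(\<Prod>b\<in>Basis. indicator (A2 b) (x \<bullet> b) :: ennreal) = (\<Prod>ij\<in>UNIV. indicator (A ij) (x $ fst ij $ snd ij))"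
        unfolding e_range[symmetric]
        by (subst prod.reindex[OF e_inj]) (simp add: A2_def inv_f_f[OF e_inj] xe)
      also have "\<dots> = indicator (C -` Pi\<^sub>E UNIV A) x"
      proof -
        have "x \<in> C -` Pi\<^sub>E UNIV A \<longleftrightarrow> (\<forall>ij. x $ fst ij $ snd ij \<in> A ij)"
          by (simp add: C_def PiE_iff)
        moreover have "(\<Prod>ij\<in>UNIV. indicator (A ij) (x $ fst ij $ snd ij) :: ennreal) =
            (if \<forall>ij. x $ fst ij $ snd ij \<in> A ij then 1 else 0)"
          by (auto intro!: prod.neutral simp: prod_zero_iff indicator_def)
        ultimately show ?thesis by (simp add: indicator_def)
      qed
      finally show "indicator (C -` Pi\<^sub>E UNIV A) x = (\<Prod>b\<in>Basis. indicator (A2 b) (x \<bullet> b) :: ennreal)" ..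
    qed
    also have "\<dots> = (\<Prod>b\<in>Basis. \<integral>\<^sup>+y. indicator (A2 b) y \<partial>gauss)"
      by (subst nn_integral_gauss_prod) (auto simp: A2_def)
    also have "\<dots> = (\<Prod>ij\<in>UNIV. emeasure ?N (A ij))"
      unfolding e_range[symmetric]
      by (subst prod.reindex[OF e_inj]) (simp add: A2_def inv_f_f[OF e_inj] gauss_real[symmetric])
    finally show "emeasure (distr gauss (\<Pi>\<^sub>M ij\<in>UNIV. borel) C) (Pi\<^sub>E UNIV A) =
        (\<Prod>ij\<in>UNIV. emeasure ?N (A ij))" .
  qed (auto intro!: prob_space_imp_sigma_finite prob_space_normal_density
         simp: product_sigma_finite_def)
  finally have eq: "distr M (\<Pi>\<^sub>M ij\<in>UNIV. borel) (\<lambda>\<omega>. C (\<Omega> \<omega>)) = distr gauss (\<Pi>\<^sub>M ij\<in>UNIV. borel) C" .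
  have "distr M borel \<Omega> = distr (distr M (\<Pi>\<^sub>M ij\<in>UNIV. borel) (\<lambda>\<omega>. C (\<Omega> \<omega>))) borel R"
    by (subst distr_distr) (auto simp: o_def RC)
  also have "\<dots> = distr gauss borel (R \<circ> C)"
    unfolding eq by (subst distr_distr) auto
  also have "\<dots> = gauss"
    using distr_id2[of borel gauss] by (simp add: o_def RC id_def)
  finally show "distr M borel \<Omega> = gauss" .
qed

section \<open>Rank-one matrices and the action on row vectors\<close>

definition outer :: "real ^ 'p \<Rightarrow> real ^ 'q \<Rightarrow> real ^ 'q ^ 'p" where
  "outer b w = (\<chi> i. b $ i *\<^sub>R w)"

text \<open>So \<open>outer b\<close> is the adjoint of \<open>X \<mapsto> b v* X\<close>, as the
  coisometry and projection lemmas require.\<close>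

lemma inner_outer: "outer b w \<bullet> Y = w \<bullet> (b v* Y)"
proof -
  have "w \<bullet> (b v* Y) = (\<Sum>j\<in>UNIV. \<Sum>i\<in>UNIV. b $ i * w $ j * Y $ i $ j)"
    by (simp add: inner_vec_def vector_matrix_mult_def sum_distrib_left mult_ac)
  also have "\<dots> = (\<Sum>i\<in>UNIV. \<Sum>j\<in>UNIV. b $ i * w $ j * Y $ i $ j)"
    by (rule sum.swap)
  finally show ?thesis by (simp add: outer_def inner_vec_def mult.assoc sum_distrib_left)
qed

lemma vector_matrix_outer: "v v* outer b w = (v \<bullet> b) *\<^sub>R w"
  by (simp add: outer_def vector_matrix_mult_def vec_eq_iff inner_vec_def sum_distrib_right mult.assoc)

lemma outer_linear: "linear (outer b)"
  by (rule linearI) (auto simp: outer_def vec_eq_iff algebra_simps)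

lemma norm_outer: "norm (outer b w) = norm b * norm w"
  by (simp add: norm_eq_sqrt_inner inner_outer vector_matrix_outer real_sqrt_mult)

lemma vector_matrix_linear: "linear (\<lambda>X :: real ^ 'q ^ 'p. v v* X)"
  by (rule linearI) (auto simp: vector_matrix_mult_add_rdistrib vector_scaleR_matrix_ac)

lemma vector_matrix_linear_left: "linear (\<lambda>v. v v* (X :: real ^ 'q ^ 'p))"
  by (rule linearI) (auto simp: vector_matrix_left_distrib scaleR_vector_matrix_assoc)

lemma borel_measurable_vector_matrix [measurable]:
  "(\<lambda>X :: real ^ 'q ^ 'p. v v* X) \<in> borel_measurable borel"
  using vector_matrix_linear[of v]
  by (auto intro!: borel_measurable_continuous_onI linear_continuous_on simp: linear_conv_bounded_linear)

lemma matrix_mult_row: "(A ** X) $ i = A $ i v* X"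
  by (simp add: matrix_matrix_mult_def vector_matrix_mult_def vec_eq_iff)

lemma nn_integral_gauss_vector_matrix:
  fixes b :: "real ^ 'p" and F :: "real ^ 'q \<Rightarrow> ennreal"
  assumes b: "norm b = 1" and F: "F \<in> borel_measurable borel"
  shows "(\<integral>\<^sup>+X. F (b v* X) \<partial>gauss) = (\<integral>\<^sup>+x. F x \<partial>gauss)"
  using b
  by (intro nn_integral_gauss_coisometry[OF vector_matrix_linear outer_linear[of b]] F)
     (auto simp: inner_outer vector_matrix_outer norm_eq_1)

text \<open>In \<open>ennreal\<close>, \<open>0 / 0 = 0\<close> and \<open>x / 0 = \<infinity>\<close> for \<open>x > 0\<close>.\<close>

definition ratio :: "real ^ 'p \<Rightarrow> real ^ 'p \<Rightarrow> real ^ 'q ^ 'p \<Rightarrow> ennreal" where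
  "ratio v u X = ennreal \<bar>u \<bullet> v\<bar> / ennreal (norm (v v* X))"

text \<open>Write \<open>v = (v \<bullet> b) b + w\<close> with \<open>b\<close> the direction of
  \<open>u\<close> and \<open>w\<close> orthogonal to it. Projecting \<open>v v* X\<close> away from
  all vectors \<open>w v* X\<close> leaves \<open>v \<bullet> b\<close> times a projection of
  \<open>b v* X\<close>, so the ratio is at most \<open>norm u\<close> over the length of that
  projection, for all \<open>v\<close> at once.\<close>

lemma nn_integral_gauss_ratio_le:
  fixes V :: "(real ^ 'p) set" and D :: "(real ^ 'p) set" and u :: "real ^ 'p"
  assumes V: "subspace V" and dimV: "dim V + d \<le> CARD('q)" and d: "d \<ge> 2"
    and D: "countable D" "D \<subseteq> V" and u: "u \<in> V"
  shows "(\<integral>\<^sup>+X. (SUP v\<in>D. ratio v u (X :: real ^ 'q ^ 'p) ^ d) \<partial>gauss) \<le>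
    ennreal (norm u ^ d / normal_abs_moment d)"
proof (cases "u = 0")
  case True
  then have "(SUP v\<in>D. ratio v u X ^ d) = 0" for X :: "real ^ 'q ^ 'p"
    using d by (intro antisym SUP_least) (simp_all add: ratio_def zero_power)
  then show ?thesis by simp
next
  case False
  define b where "b = sgn u"
  have "norm b = 1" using False by (simp add: b_def norm_sgn)
  moreover have "b \<in> V" "u = norm u *\<^sub>R b"
    using False u V by (auto simp: b_def sgn_div_norm subspace_scale)
  ultimately have b: "norm b = 1" "b \<bullet> b = 1" "b \<in> V" "u = norm u *\<^sub>R b"
    using norm_eq_1[of b] by auto
  define P where "P = (\<lambda>X :: real ^ 'q ^ 'p. outer b (b v* X))"
  define W where "W = {w \<in> V. b \<bullet> w = 0}"
  have W: "subspace W"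
    using V by (auto simp: W_def subspace_def inner_add_right)
  \<comment> \<open>Losing the direction of \<open>u\<close> leaves room for \<open>d + 1\<close>
    directions orthogonal to the image of \<open>W\<close>; in only \<open>d\<close> dimensions the
    inverse \<open>d\<close>-th moment would be infinite.\<close>
  have "dim W < dim V"
  proof (rule dim_psubset)
    have "b \<notin> W" "W \<subseteq> V" using b by (auto simp: W_def)
    moreover have "span W = W" "span V = V" using V W by (simp_all add: span_eq_iff)
    ultimately show "span W \<subset> span V"
      using b(3) by (metis psubsetI)
  qed
  have [measurable]: "ratio v u \<in> borel_measurable borel" for v and u
    unfolding ratio_def divide_ennreal_def by simp
  let ?F = "\<lambda>X :: real ^ 'q ^ 'p. SUP v\<in>D. ratio v u X ^ d"
  have [measurable]: "?F \<in> borel_measurable borel"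
    using D(1) by measurable
  \<comment> \<open>\<open>P\<close> isolates \<open>b v* X\<close>, which is independent of all
    \<open>w v* X\<close> with \<open>w\<close> in \<open>W\<close>.\<close>
  have "(\<integral>\<^sup>+X. ?F X \<partial>gauss) = (\<integral>\<^sup>+Y. \<integral>\<^sup>+X. ?F (P X + (Y - P Y)) \<partial>gauss \<partial>gauss)"
  proof (rule nn_integral_gauss_split)
    show "linear P"
      unfolding P_def by (rule linear_compose[OF vector_matrix_linear outer_linear, unfolded o_def])
    show "P x \<bullet> y = x \<bullet> P y" for x y
      unfolding P_def inner_commute[of x] inner_outer by (rule inner_commute)
    show "P (P x) = P x" for x by (simp add: P_def vector_matrix_outer b)
  qed simp
  also have "\<dots> \<le> (\<integral>\<^sup>+(Y :: real ^ 'q ^ 'p). ennreal (norm u ^ d / normal_abs_moment d) \<partial>gauss)"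
  proof (rule nn_integral_mono)
    fix Y :: "real ^ 'q ^ 'p"
    \<comment> \<open>\<open>H\<close> depends on \<open>Y\<close> alone, so the directions
      \<open>E\<close> stay fixed while \<open>X\<close> is integrated out.\<close>
    define H where "H = (\<lambda>w. w v* Y) ` W"
    have "subspace H" unfolding H_def using vector_matrix_linear_left W by (rule linear_subspace_image)
    moreover have "dim H \<le> dim W" unfolding H_def using vector_matrix_linear_left by (rule dim_image_le)
    then have "dim H + (d + 1) \<le> DIM(real ^ 'q)" using dimV \<open>dim W < dim V\<close> by simp
    ultimately obtain E where E: "finite E" "pairwise orthogonal E" "\<And>e. e \<in> E \<Longrightarrow> norm e = 1"
        "card E = d + 1" "\<And>e h. e \<in> E \<Longrightarrow> h \<in> H \<Longrightarrow> h \<bullet> e = 0"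
      using exists_orthonormal_complement by blast
    interpret E: orthonormal_set E using E by unfold_locales auto
    let ?n = "\<lambda>x. sqrt (\<Sum>e\<in>E. (x \<bullet> e)\<^sup>2)"
    have bound: "?F (P X + (Y - P Y)) \<le> ennreal (norm u ^ d) * inverse (ennreal (?n (b v* X))) ^ d" for X
    proof (rule SUP_least)
      fix v assume "v \<in> D"
      then have v: "v \<in> V" using D by auto
      let ?x = "b v* X"
      have eq: "v v* (P X + (Y - P Y)) = (v \<bullet> b) *\<^sub>R ?x + (v - (v \<bullet> b) *\<^sub>R b) v* Y"
        by (simp add: P_def vector_matrix_mult_add_rdistrib vector_matrix_mult_diff_rdistrib
            vector_matrix_outer vector_matrix_mult_diff_distrib scaleR_vector_matrix_assoc)
      have uv: "\<bar>u \<bullet> v\<bar> = norm u * \<bar>v \<bullet> b\<bar>"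
        by (subst b(4)) (simp add: abs_mult inner_commute)
      have "(v - (v \<bullet> b) *\<^sub>R b) \<in> W"
        using v b V by (auto simp: W_def subspace_diff subspace_scale inner_diff_right inner_commute)
      then have h: "(v - (v \<bullet> b) *\<^sub>R b) v* Y \<in> H" by (auto simp: H_def)
      have "\<bar>v \<bullet> b\<bar> * ?n ?x = norm (onproj E (v v* (P X + (Y - P Y))))"
        using E(5)[OF _ h]
        by (simp add: eq E.norm_onproj inner_add_left power_mult_distrib sum_distrib_left[symmetric] real_sqrt_mult)
      also have "\<dots> \<le> norm (v v* (P X + (Y - P Y)))" by (rule E.norm_onproj_le)
      finally have le: "\<bar>v \<bullet> b\<bar> * ?n ?x \<le> norm (v v* (P X + (Y - P Y)))" .
      have "ratio v u (P X + (Y - P Y)) \<le> ennreal (norm u) * inverse (ennreal (?n ?x))"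
      \<comment> \<open>If \<open>v \<bullet> b = 0\<close> the ratio is \<open>0\<close>, even over
        a zero denominator; if the projected length vanishes, the bound is infinite because
        \<open>u \<noteq> 0\<close>.\<close>
      proof (cases "v \<bullet> b = 0 \<or> ?n ?x = 0")
        case True
        then show ?thesis
          using \<open>u \<noteq> 0\<close> by (auto simp: ratio_def uv ennreal_mult_top)
      next
        case False
        then have pos: "\<bar>v \<bullet> b\<bar> > 0" "?n ?x > 0" by (auto simp: sum_nonneg less_le)
        then have "\<bar>v \<bullet> b\<bar> * ?n ?x > 0" by (rule mult_pos_pos)
        with le have pos2: "norm (v v* (P X + (Y - P Y))) > 0" by linarith
        have "ratio v u (P X + (Y - P Y)) = ennreal (norm u * \<bar>v \<bullet> b\<bar> / norm (v v* (P X + (Y - P Y))))"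
          unfolding ratio_def uv by (rule divide_ennreal) (use pos2 in auto)
        also have "\<dots> \<le> ennreal (norm u * \<bar>v \<bullet> b\<bar> / (\<bar>v \<bullet> b\<bar> * ?n ?x))"
          using le pos pos2 by (intro ennreal_leI divide_left_mono mult_pos_pos) auto
        also have "norm u * \<bar>v \<bullet> b\<bar> / (\<bar>v \<bullet> b\<bar> * ?n ?x) = norm u * inverse (?n ?x)"
          using pos(1) by (simp add: divide_inverse)
        also have "ennreal (norm u * inverse (?n ?x)) = ennreal (norm u) * inverse (ennreal (?n ?x))"
          using pos(2) by (simp add: ennreal_mult' inverse_ennreal)
        finally show ?thesis .
      qed
      then have "ratio v u (P X + (Y - P Y)) ^ d \<le> (ennreal (norm u) * inverse (ennreal (?n ?x))) ^ d"
        by (intro power_mono) auto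
      then show "ratio v u (P X + (Y - P Y)) ^ d \<le> ennreal (norm u ^ d) * inverse (ennreal (?n ?x)) ^ d"
        by (simp add: power_mult_distrib ennreal_power)
    qed
    have "(\<integral>\<^sup>+X. ?F (P X + (Y - P Y)) \<partial>gauss) \<le>
        (\<integral>\<^sup>+X. ennreal (norm u ^ d) * inverse (ennreal (?n (b v* X))) ^ d \<partial>gauss)"
      by (intro nn_integral_mono bound)
    also have "\<dots> = (\<integral>\<^sup>+x. ennreal (norm u ^ d) * inverse (ennreal (?n x)) ^ d \<partial>gauss)"
      by (rule nn_integral_gauss_vector_matrix[OF b(1)]) measurable
    also have "\<dots> = ennreal (norm u ^ d) * (\<integral>\<^sup>+x. inverse (ennreal (?n x)) ^ d \<partial>gauss)"
      by (rule nn_integral_cmult) measurable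
    also have "\<dots> \<le> ennreal (norm u ^ d) * ennreal (1 / normal_abs_moment d)"
      using E d by (intro mult_left_mono nn_integral_gauss_inverse_power) auto
    also have "\<dots> = ennreal (norm u ^ d / normal_abs_moment d)"
      by (simp add: ennreal_mult'[symmetric])
    finally show "(\<integral>\<^sup>+X. ?F (P X + (Y - P Y)) \<partial>gauss) \<le> ennreal (norm u ^ d / normal_abs_moment d)" .
  qed
  also have "\<dots> = ennreal (norm u ^ d / normal_abs_moment d)"
    using gauss.emeasure_space_1[where ?'a="real ^ 'q ^ 'p"] by simp
  finally show ?thesis .
qed

text \<open>Its supremum over \<open>V\<close> is \<tau>. Values in \<open>ennreal\<close> make
  \<tau> infinite when some nonzero \<open>v\<close> in \<open>V\<close> is sent to zero, while
  \<open>v = 0\<close> contributes \<open>0\<close>.\<close>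

definition gain :: "real ^ 'p \<Rightarrow> real ^ 'q ^ 'p \<Rightarrow> ennreal" where
  "gain v X = ennreal (norm v) / ennreal (norm (v v* X))"

lemma borel_measurable_gain [measurable]: "gain v \<in> borel_measurable borel"
  unfolding gain_def divide_ennreal_def by simp

lemma nn_integral_gauss_sup_gain_power_le:
  fixes V D :: "(real ^ 'p) set"
  assumes V: "subspace V" and dimV: "dim V \<le> k" and k: "k \<ge> 1" "k + d = CARD('q)" and d: "d \<ge> 2"
    and D: "countable D" "D \<subseteq> V"
  shows "(\<integral>\<^sup>+X. (SUP v\<in>D. gain v (X :: real ^ 'q ^ 'p) ^ d) \<partial>gauss) \<le>
    ennreal (sqrt (real CARD('q)) ^ d / (normal_abs_moment d)\<^sup>2)"
    (is "?A \<le> _")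
proof -
  obtain S where S: "S \<subseteq> V" "pairwise orthogonal S" "\<And>x. x \<in> S \<Longrightarrow> norm x = 1"
      "independent S" "card S = dim V" "span S = V"
    using V by (metis orthonormal_basis_subspace)
  have fin: "finite S" using S(4) independent_imp_finite by blast
  interpret S: orthonormal_set S using S fin by unfold_locales auto
  define m where "m = normal_abs_moment d"
  have m: "m > 0" by (simp add: m_def normal_abs_moment_pos)
  have [measurable]: "onproj S \<in> borel_measurable borel"
    using onproj_linear[of S]
    by (auto intro!: borel_measurable_continuous_onI linear_continuous_on simp: linear_conv_bounded_linear)
  have [measurable]: "(\<lambda>z. ratio v (onproj S (snd z)) (fst z)) \<in>
      borel_measurable ((gauss :: (real ^ 'q ^ 'p) measure) \<Otimes>\<^sub>M gauss)" for v
    unfolding ratio_def divide_ennreal_def by measurable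
  have [measurable]: "(\<lambda>z. SUP v\<in>D. ratio v (onproj S (snd z)) (fst z) ^ d) \<in>
      borel_measurable ((gauss :: (real ^ 'q ^ 'p) measure) \<Otimes>\<^sub>M gauss)"
    using D(1) by measurable
  \<comment> \<open>For one \<open>v\<close>, averaging over \<open>g\<close> gives exactly
    \<open>m * gain v X ^ d\<close>, and a supremum under the integral only increases this.
    Projecting \<open>g\<close> to \<open>V\<close> changes no inner product with \<open>v\<close>
    and provides a vector \<open>u\<close> in \<open>V\<close> for the ratio bound.\<close>
  have pointwise: "ennreal m * (SUP v\<in>D. gain v X ^ d) \<le> (\<integral>\<^sup>+g. (SUP v\<in>D. ratio v (onproj S g) X ^ d) \<partial>gauss)"
    for X :: "real ^ 'q ^ 'p"
    unfolding SUP_mult_left_ennreal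
  proof (rule SUP_least)
    fix v assume v: "v \<in> D"
    then have "onproj S v = v" using D S(6) S.onproj_span by auto
    then have gv: "onproj S g \<bullet> v = g \<bullet> v" for g by (simp add: onproj_inner_commute)
    have "ennreal m * gain v X ^ d = ennreal (norm v ^ d * m) * inverse (ennreal (norm (v v* X))) ^ d"
      using m by (simp add: gain_def divide_ennreal_def power_mult_distrib ennreal_power ennreal_mult' mult_ac)
    also have "\<dots> = (\<integral>\<^sup>+g. ennreal (\<bar>g \<bullet> v\<bar> ^ d) * inverse (ennreal (norm (v v* X))) ^ d \<partial>gauss)"
      unfolding m_def by (subst nn_integral_multc) (simp_all add: nn_integral_gauss_inner_power)
    also have "\<dots> = (\<integral>\<^sup>+g. ratio v (onproj S g) X ^ d \<partial>gauss)"
      by (simp add: ratio_def divide_ennreal_def power_mult_distrib ennreal_power gv)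
    also have "\<dots> \<le> (\<integral>\<^sup>+g. (SUP v\<in>D. ratio v (onproj S g) X ^ d) \<partial>gauss)"
      using v by (intro nn_integral_mono SUP_upper)
    finally show "ennreal m * gain v X ^ d \<le> (\<integral>\<^sup>+g. (SUP v\<in>D. ratio v (onproj S g) X ^ d) \<partial>gauss)" .
  qed
  have "ennreal m * ?A = (\<integral>\<^sup>+X. ennreal m * (SUP v\<in>D. gain v (X :: real ^ 'q ^ 'p) ^ d) \<partial>gauss)"
    using D(1) by (subst nn_integral_cmult) measurable
  also have "\<dots> \<le> (\<integral>\<^sup>+X. \<integral>\<^sup>+g. (SUP v\<in>D. ratio v (onproj S g) (X :: real ^ 'q ^ 'p) ^ d) \<partial>gauss \<partial>gauss)"
    by (intro nn_integral_mono pointwise)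
  also have "\<dots> = (\<integral>\<^sup>+g. \<integral>\<^sup>+X. (SUP v\<in>D. ratio v (onproj S g) (X :: real ^ 'q ^ 'p) ^ d) \<partial>gauss \<partial>gauss)"
    by (rule gauss_pair.Fubini'[symmetric]) (simp add: split_beta')
  also have "\<dots> \<le> (\<integral>\<^sup>+g. ennreal (norm (onproj S g) ^ d / m) \<partial>gauss)"
    unfolding m_def
    using V dimV k d D S(6) onproj_in_span[of S]
    by (intro nn_integral_mono nn_integral_gauss_ratio_le[of V]) auto
  also have "\<dots> = (\<integral>\<^sup>+g. ennreal (1 / m) * ennreal (sqrt (\<Sum>e\<in>S. (g \<bullet> e)\<^sup>2) ^ d) \<partial>gauss)"
    using m by (simp add: S.norm_onproj ennreal_mult'[symmetric])
  also have "\<dots> = ennreal (1 / m) * (\<integral>\<^sup>+g. ennreal (sqrt (\<Sum>e\<in>S. (g \<bullet> e)\<^sup>2) ^ d) \<partial>gauss)"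
    by (rule nn_integral_cmult) measurable
  also have "\<dots> \<le> ennreal (1 / m) * ennreal (sqrt (real CARD('q)) ^ d)"
    unfolding k(2)[symmetric]
    using S fin dimV k by (intro mult_left_mono nn_integral_gauss_power_sum_squares_le) auto
  also have "\<dots> = ennreal m * ennreal (sqrt (real CARD('q)) ^ d / m\<^sup>2)"
    using m by (simp add: ennreal_mult'[symmetric] power2_eq_square)
  finally show ?thesis
    using m unfolding m_def[symmetric] by (subst (asm) ennreal_mult_le_mult_iff) simp_all
qed

lemma nn_integral_gauss_sup_gain_square_le:
  fixes V D :: "(real ^ 'p) set"
  assumes V: "subspace V" and dimV: "dim V \<le> k" and k: "k \<ge> 1" "k + d = CARD('q)" and d: "d \<ge> 2"
    and D: "countable D" "D \<subseteq> V"
  shows "(\<integral>\<^sup>+X. (SUP v\<in>D. (gain v (X :: real ^ 'q ^ 'p))\<^sup>2) \<partial>gauss) \<le>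
      ennreal ((exp 1)\<^sup>2 * real CARD('q) / ((real d)\<^sup>2 - 1))"
    and "AE X in gauss. (SUP v\<in>D. (gain v (X :: real ^ 'q ^ 'p))\<^sup>2) < \<infinity>"
proof -
  \<comment> \<open>\<open>c\<^sup>2\<close> is the claimed bound, and \<open>c ^ d\<close>
    dominates the bound \<open>K\<close> on the \<open>d\<close>-th moment; weakening
    \<open>d\<close> to \<open>sqrt (d\<^sup>2 - 1)\<close> gives the form wanted in the
    theorem.\<close>
  define c where "c = exp 1 * sqrt (real CARD('q)) / sqrt ((real d)\<^sup>2 - 1)"
  have "2 ^ 2 \<le> (real d) ^ 2" using d by (intro power_mono) auto
  then have d1: "(real d)\<^sup>2 - 1 > 0" by simp
  have c: "c > 0" using d1 by (simp add: c_def)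
  have csq: "c\<^sup>2 = (exp 1)\<^sup>2 * real CARD('q) / ((real d)\<^sup>2 - 1)"
    using d1 by (simp add: c_def power_divide power_mult_distrib)
  define K where "K = sqrt (real CARD('q)) ^ d / (normal_abs_moment d)\<^sup>2"
  have "K \<le> sqrt (real CARD('q)) ^ d / (real d / exp 1) ^ d"
    unfolding K_def using d normal_abs_moment_ge[of d] normal_abs_moment_pos[of d]
    by (intro divide_left_mono mult_pos_pos) auto
  also have "\<dots> = (exp 1 * sqrt (real CARD('q)) / real d) ^ d"
    by (simp add: power_divide power_mult_distrib)
  also have "\<dots> \<le> c ^ d"
  proof (rule power_mono)
    have "sqrt ((real d)\<^sup>2 - 1) \<le> real d" by (rule real_le_lsqrt) auto
    then show "exp 1 * sqrt (real CARD('q)) / real d \<le> c"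
      unfolding c_def using d d1 by (intro divide_left_mono mult_pos_pos) auto
  qed simp
  finally have K: "K \<le> c ^ d" .
  \<comment> \<open>The tangent inequality is applied to \<open>g / c\<close>. It is an equality at
    \<open>g = c\<close>, so \<open>\<alpha> * c ^ d + \<beta> = c\<^sup>2\<close> and nothing is
    lost in the constant.\<close>
  define \<alpha> where "\<alpha> = 2 * c\<^sup>2 / (real d * c ^ d)"
  define \<beta> where "\<beta> = c\<^sup>2 * (real d - 2) / real d"
  have ab: "\<alpha> > 0" "\<beta> \<ge> 0" using c d by (auto simp: \<alpha>_def \<beta>_def)
  have tangent: "g\<^sup>2 \<le> ennreal \<alpha> * g ^ d + ennreal \<beta>" for g :: ennreal
  proof (cases g)
    case (real r)
    have "real d * (r / c)\<^sup>2 \<le> 2 * (r / c) ^ d + real d - 2"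
      using square_le_power_tangent[of "r / c" d] real c d by simp
    then have "(c\<^sup>2 / real d) * (real d * (r / c)\<^sup>2) \<le> (c\<^sup>2 / real d) * (2 * (r / c) ^ d + (real d - 2))"
      by (intro mult_left_mono) auto
    moreover have "(c\<^sup>2 / real d) * (real d * (r / c)\<^sup>2) = r\<^sup>2"
      using c d by (simp add: power_divide)
    moreover have "(c\<^sup>2 / real d) * (2 * (r / c) ^ d + (real d - 2)) = \<alpha> * r ^ d + \<beta>"
      by (simp add: \<alpha>_def \<beta>_def power_divide distrib_left mult_ac)
    ultimately have "r\<^sup>2 \<le> \<alpha> * r ^ d + \<beta>" by simp
    then show ?thesis
      using real ab by (simp add: ennreal_power ennreal_mult'[symmetric] ennreal_plus[symmetric] ennreal_leI del: ennreal_plus)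
  next
    case top
    then show ?thesis using ab d by (simp add: ennreal_mult_top power_eq_top_ennreal)
  qed
  have sup: "(SUP v\<in>D. (gain v X)\<^sup>2) \<le> ennreal \<alpha> * (SUP v\<in>D. gain v X ^ d) + ennreal \<beta>" for X :: "real ^ 'q ^ 'p"
  proof (rule SUP_least)
    fix v assume "v \<in> D"
    have "(gain v X)\<^sup>2 \<le> ennreal \<alpha> * gain v X ^ d + ennreal \<beta>" by (rule tangent)
    also have "\<dots> \<le> ennreal \<alpha> * (SUP v\<in>D. gain v X ^ d) + ennreal \<beta>"
      using \<open>v \<in> D\<close> by (intro add_right_mono mult_left_mono SUP_upper) auto
    finally show "(gain v X)\<^sup>2 \<le> ennreal \<alpha> * (SUP v\<in>D. gain v X ^ d) + ennreal \<beta>" .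
  qed
  have meas[measurable]: "(\<lambda>X :: real ^ 'q ^ 'p. SUP v\<in>D. gain v X ^ n) \<in> borel_measurable borel" for n
    using D(1) by measurable
  have le: "(\<integral>\<^sup>+X. (SUP v\<in>D. (gain v (X :: real ^ 'q ^ 'p))\<^sup>2) \<partial>gauss) \<le> ennreal (c\<^sup>2)"
  proof -
    have "(\<integral>\<^sup>+X. (SUP v\<in>D. (gain v (X :: real ^ 'q ^ 'p))\<^sup>2) \<partial>gauss) \<le>
        (\<integral>\<^sup>+X. ennreal \<alpha> * (SUP v\<in>D. gain v (X :: real ^ 'q ^ 'p) ^ d) + ennreal \<beta> \<partial>gauss)"
      by (intro nn_integral_mono sup)
    also have "\<dots> = ennreal \<alpha> * (\<integral>\<^sup>+X. (SUP v\<in>D. gain v (X :: real ^ 'q ^ 'p) ^ d) \<partial>gauss) + ennreal \<beta>"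
      using gauss.emeasure_space_1[where ?'a="real ^ 'q ^ 'p"]
      by (subst nn_integral_add) (simp_all add: nn_integral_cmult)
    also have "\<dots> \<le> ennreal \<alpha> * ennreal K + ennreal \<beta>"
      unfolding K_def
      by (intro add_right_mono mult_left_mono nn_integral_gauss_sup_gain_power_le[OF assms]) simp
    also have "\<dots> \<le> ennreal \<alpha> * ennreal (c ^ d) + ennreal \<beta>"
      by (intro add_right_mono mult_left_mono ennreal_leI K) simp
    also have "\<dots> = ennreal (\<alpha> * c ^ d + \<beta>)"
      using ab c by (simp add: ennreal_mult'[symmetric])
    also have "\<alpha> * c ^ d + \<beta> = c\<^sup>2"
      using c d by (simp add: \<alpha>_def \<beta>_def add_divide_distrib[symmetric]) (simp add: algebra_simps)
    finally show ?thesis .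
  qed
  then show "(\<integral>\<^sup>+X. (SUP v\<in>D. (gain v (X :: real ^ 'q ^ 'p))\<^sup>2) \<partial>gauss) \<le>
      ennreal ((exp 1)\<^sup>2 * real CARD('q) / ((real d)\<^sup>2 - 1))"
    by (simp add: csq)
  have "AE X in gauss. (SUP v\<in>D. (gain v (X :: real ^ 'q ^ 'p))\<^sup>2) \<noteq> \<infinity>"
    using le by (intro nn_integral_PInf_AE) (auto simp: top_unique)
  then show "AE X in gauss. (SUP v\<in>D. (gain v (X :: real ^ 'q ^ 'p))\<^sup>2) < \<infinity>"
    by (simp only: less_top infinity_ennreal_def)
qed

section \<open>Second moments and independence of the residual\<close>

lemma norm_matrix_square: "(norm (A :: real ^ 'n ^ 'm))\<^sup>2 = (\<Sum>i\<in>UNIV. \<Sum>j\<in>UNIV. (A $ i $ j)\<^sup>2)"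
  by (simp add: frobenius_norm_eq_norm[symmetric] frobenius_norm_def sum_nonneg)

text \<open>Each entry of \<open>A ** X\<close> is the inner product of \<open>X\<close> with a
  rank-one matrix whose norm is that of the corresponding row of \<open>A\<close>; each row occurs
  once for every column of \<open>X\<close>.\<close>

lemma nn_integral_gauss_norm_mult_square:
  fixes A :: "real ^ 'p ^ 'm"
  shows "(\<integral>\<^sup>+X. ennreal ((norm (A ** (X :: real ^ 'q ^ 'p)))\<^sup>2) \<partial>gauss) = ennreal (real CARD('q) * (norm A)\<^sup>2)"
proof -
  have entry: "(A ** X) $ i $ j = X \<bullet> outer (A $ i) (axis j 1)" for X :: "real ^ 'q ^ 'p" and i j
    by (simp add: matrix_mult_row inner_commute[of X] inner_outer inner_axis' )
  have mu2: "normal_abs_moment 2 = 1"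
    using normal_abs_moment_rec[of 0] by (simp add: normal_abs_moment_0 numeral_2_eq_2)
  have "(\<integral>\<^sup>+X. ennreal ((norm (A ** (X :: real ^ 'q ^ 'p)))\<^sup>2) \<partial>gauss) =
     (\<integral>\<^sup>+X. (\<Sum>i\<in>UNIV. \<Sum>j\<in>UNIV. ennreal (\<bar>X \<bullet> outer (A $ i) (axis j (1::real) :: real ^ 'q)\<bar> ^ 2)) \<partial>gauss)"
    by (simp add: norm_matrix_square entry sum_nonneg)
  also have "\<dots> = (\<Sum>i\<in>UNIV. \<Sum>j\<in>(UNIV :: 'q set). ennreal ((norm (A $ i))\<^sup>2))"
    by (subst nn_integral_sum, simp, subst nn_integral_sum)
       (simp_all only: nn_integral_gauss_inner_power mu2 norm_outer norm_axis_1 mult_1_right, simp_all)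
  also have "\<dots> = ennreal (real CARD('q) * (\<Sum>i\<in>UNIV. (norm (A $ i))\<^sup>2))"
    by (simp add: sum_distrib_left ennreal_mult' ennreal_of_nat_eq_real_of_nat sum_nonneg flip: sum_ennreal)
  also have "(\<Sum>i\<in>UNIV. (norm (A $ i))\<^sup>2) = (norm A)\<^sup>2"
    by (simp add: norm_vec_def L2_set_def sum_nonneg)
  finally show ?thesis .
qed

lemma borel_measurable_norm_mult [measurable]:
  fixes A :: "real ^ 'p ^ 'm"
  shows "(\<lambda>X :: real ^ 'q ^ 'p. norm (A ** X)) \<in> borel_measurable borel"
  unfolding norm_vec_def[of "A ** _"] L2_set_def matrix_mult_row by measurable

text \<open>The gains depend only on \<open>P X\<close>, because \<open>D\<close> lies in
  \<open>span S\<close>. The product \<open>A ** X\<close> depends only on \<open>X - P X\<close>,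
  because the rows of \<open>A\<close> are orthogonal to \<open>S\<close>. The Gaussian split
  therefore separates the two factors.\<close>

lemma nn_integral_gauss_gain_independent:
  fixes A :: "real ^ 'p ^ 'm" and D :: "(real ^ 'p) set"
  assumes S: "orthonormal_set S" and D: "countable D" "D \<subseteq> span S"
    and A: "\<And>i. onproj S (A $ i) = 0"
  shows "(\<integral>\<^sup>+X. (SUP v\<in>D. (gain v (X :: real ^ 'q ^ 'p))\<^sup>2) * ennreal ((norm (A ** X))\<^sup>2) \<partial>gauss) =
    (\<integral>\<^sup>+X. (SUP v\<in>D. (gain v (X :: real ^ 'q ^ 'p))\<^sup>2) \<partial>gauss) * ennreal (real CARD('q) * (norm A)\<^sup>2)"
proof -
  interpret orthonormal_set S by fact
  define P where "P = (\<lambda>X :: real ^ 'q ^ 'p. \<Sum>b\<in>S. outer b (b v* X))"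
  have vP: "v v* P X = onproj S v v* X" for v X
    unfolding P_def onproj_def
    by (simp add: linear_sum[OF vector_matrix_linear] linear_sum[OF vector_matrix_linear_left]
        vector_matrix_outer scaleR_vector_matrix_assoc)
  have lin: "linear P"
    unfolding P_def
    by (intro linear_compose_sum ballI linear_compose[OF vector_matrix_linear outer_linear, unfolded o_def])
  have adj: "P x \<bullet> y = x \<bullet> P y" for x y
    unfolding P_def inner_sum_left inner_sum_right
    by (intro sum.cong refl) (simp add: inner_outer inner_commute[of x], simp add: inner_commute)
  have idem: "P (P X) = P X" for X
  proof -
    have "P (P X) = (\<Sum>b\<in>S. outer b (b v* P X))" by (simp add: P_def)
    also have "\<dots> = (\<Sum>b\<in>S. outer b (b v* X))" by (intro sum.cong refl) (simp add: vP onproj_base)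
    finally show "P (P X) = P X" by (simp add: P_def)
  qed
  let ?G = "\<lambda>X :: real ^ 'q ^ 'p. SUP v\<in>D. (gain v X)\<^sup>2"
  have [measurable]: "?G \<in> borel_measurable borel"
    using D(1) by measurable
  have G: "?G (P X + (Y - P Y)) = ?G X" for X Y
  proof (intro SUP_cong refl)
    fix v assume "v \<in> D"
    then have "onproj S v = v" using D onproj_span by auto
    then have "v v* (P X + (Y - P Y)) = v v* X"
      by (simp add: vector_matrix_mult_add_rdistrib vector_matrix_mult_diff_rdistrib vP)
    then show "(gain v (P X + (Y - P Y)))\<^sup>2 = (gain v X)\<^sup>2" by (simp add: gain_def)
  qed
  have AX: "A ** (P X + (Y - P Y)) = A ** Y" for X Y
    by (rule vec_eq_iff[THEN iffD2], rule allI) (simp add: matrix_mult_row vector_matrix_mult_add_rdistrib vector_matrix_mult_diff_rdistrib vP A)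
  have "(\<integral>\<^sup>+X. ?G X * ennreal ((norm (A ** X))\<^sup>2) \<partial>gauss) =
     (\<integral>\<^sup>+Y. \<integral>\<^sup>+X. ?G X * ennreal ((norm (A ** (Y :: real ^ 'q ^ 'p)))\<^sup>2) \<partial>gauss \<partial>gauss)"
  proof -
    have "(\<lambda>X :: real ^ 'q ^ 'p. ?G X * ennreal ((norm (A ** X))\<^sup>2)) \<in> borel_measurable borel"
      by measurable
    from nn_integral_gauss_split[OF lin adj idem this] show ?thesis
      unfolding G AX .
  qed
  also have "\<dots> = (\<integral>\<^sup>+Y. (\<integral>\<^sup>+X. ?G X \<partial>gauss) * ennreal ((norm (A ** (Y :: real ^ 'q ^ 'p)))\<^sup>2) \<partial>gauss)"
    by (intro nn_integral_cong nn_integral_multc) measurable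
  also have "\<dots> = (\<integral>\<^sup>+X. ?G X \<partial>gauss) * ennreal (real CARD('q) * (norm A)\<^sup>2)"
    unfolding nn_integral_gauss_norm_mult_square[symmetric]
    by (intro nn_integral_cmult) measurable
  finally show ?thesis .
qed

section \<open>The projection error\<close>

lemma inner_matrix_mult_left: "(A ** X) \<bullet> Y = X \<bullet> (transpose A ** Y)"
  for A :: "real ^ 'n ^ 'm" and X :: "real ^ 'q ^ 'n"
proof -
  have "(A ** X) \<bullet> Y = (\<Sum>i\<in>UNIV. \<Sum>j\<in>UNIV. \<Sum>k\<in>UNIV. A $ i $ k * X $ k $ j * Y $ i $ j)"
    by (simp add: inner_vec_def matrix_matrix_mult_def sum_distrib_right)
  also have "\<dots> = (\<Sum>i\<in>UNIV. \<Sum>k\<in>UNIV. \<Sum>j\<in>UNIV. A $ i $ k * X $ k $ j * Y $ i $ j)"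
    by (intro sum.cong refl sum.swap)
  also have "\<dots> = (\<Sum>k\<in>UNIV. \<Sum>i\<in>UNIV. \<Sum>j\<in>UNIV. A $ i $ k * X $ k $ j * Y $ i $ j)"
    by (rule sum.swap)
  also have "\<dots> = (\<Sum>k\<in>UNIV. \<Sum>j\<in>UNIV. \<Sum>i\<in>UNIV. A $ i $ k * X $ k $ j * Y $ i $ j)"
    by (intro sum.cong refl sum.swap)
  also have "\<dots> = X \<bullet> (transpose A ** Y)"
    by (simp add: inner_vec_def matrix_matrix_mult_def transpose_def sum_distrib_left mult_ac)
  finally show ?thesis .
qed

text \<open>\<open>U ** transpose U\<close> is symmetric and idempotent, so Pythagoras
  applies.\<close>

lemma norm_diff_matrix_projection_le:
  fixes U :: "real ^ 'k ^ 'm" and X :: "real ^ 'n ^ 'm"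
  assumes U: "transpose U ** U = mat 1"
  shows "norm (X - U ** transpose U ** X) \<le> norm X"
proof -
  define P where "P = U ** transpose U"
  have sym: "transpose P = P" by (simp add: P_def matrix_transpose_mul)
  have "P ** P = U ** (transpose U ** U) ** transpose U"
    by (simp only: P_def matrix_mul_assoc)
  then have idem: "P ** P = P" by (simp add: U P_def)
  have "(P ** X) \<bullet> (P ** X) = X \<bullet> (P ** X)"
    using inner_matrix_mult_left[of P X "P ** X"] by (simp add: sym matrix_mul_assoc idem)
  then have "(X - P ** X) \<bullet> (P ** X) = 0" by (simp add: inner_diff_left)
  then have "(norm ((X - P ** X) + P ** X))\<^sup>2 = (norm (X - P ** X))\<^sup>2 + (norm (P ** X))\<^sup>2"
    by (intro norm_add_Pythagorean) (simp add: orthogonal_def)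
  then have "(norm (X - P ** X))\<^sup>2 \<le> (norm X)\<^sup>2" by simp
  then show ?thesis unfolding P_def by (rule power2_le_imp_le) simp
qed

lemma norm_le_norm_mult:
  fixes C :: "real ^ 'p ^ 'm" and X :: "real ^ 'q ^ 'p"
  assumes "\<And>i. norm (C $ i) \<le> t * norm (C $ i v* X)" and t: "t \<ge> 0"
  shows "norm C \<le> t * norm (C ** X)"
proof -
  have "norm C \<le> L2_set (\<lambda>i. t * norm (C $ i v* X)) UNIV"
    unfolding norm_vec_def[of C] using assms by (intro L2_set_mono) auto
  also have "\<dots> = t * norm (C ** X)"
    by (simp add: L2_set_right_distrib t norm_vec_def[of "C ** X"] matrix_mult_row)
  finally show ?thesis .
qed

text \<open>The error splits into \<open>F\<close> and a part of norm at most \<open>norm E\<close>.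
  The rows of \<open>F\<close> lie in \<open>V\<close>, so \<open>F\<close> is controlled by
  \<open>F ** X\<close>. That is a difference of two residuals, each at most
  \<open>norm (E ** X)\<close>: one by optimality, one by contraction. Hence the factor
  \<open>2\<close>.\<close>

lemma projection_error_le:
  fixes B C :: "real ^ 'p ^ 'm" and U :: "real ^ 'k ^ 'm" and X :: "real ^ 'q ^ 'p"
  assumes U: "transpose U ** U = mat 1"
    and opt: "norm (B ** X - U ** transpose U ** (B ** X)) \<le> norm ((B - C) ** X)"
    and V: "subspace V" "\<And>i. C $ i \<in> V"
    and t: "t \<ge> 0" "\<And>v. v \<in> V \<Longrightarrow> norm v \<le> t * norm (v v* X)"
  shows "norm (B - U ** transpose U ** B) \<le> norm (B - C) + 2 * (t * norm ((B - C) ** X))"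
proof -
  define P where "P = U ** transpose U"
  define E where "E = B - C"
  have dist: "M - P ** M = (M1 - P ** M1) + (M2 - P ** M2)" if "M = M1 + M2"
    for M M1 M2 :: "real ^ 'z ^ 'm"
    by (simp add: that matrix_add_ldistrib)
  define F where "F = C - P ** C"
  \<comment> \<open>Left multiplication by \<open>P\<close> only forms linear combinations of rows,
    so it preserves the row space.\<close>
  have "F $ i \<in> V" for i
  proof -
    have "(P ** C) $ i = (\<Sum>k\<in>UNIV. P $ i $ k *\<^sub>R C $ k)"
      by (simp add: matrix_matrix_mult_def vec_eq_iff)
    also have "\<dots> \<in> V" using V by (intro subspace_sum subspace_scale) auto
    finally show ?thesis using V by (simp add: F_def subspace_diff)
  qed
  then have F: "norm F \<le> t * norm (F ** X)"
    using t by (intro norm_le_norm_mult) auto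
  have "B ** X = C ** X + E ** X"
    by (rule vec_eq_iff[THEN iffD2]) (simp add: E_def matrix_mult_row vector_matrix_mult_diff_distrib)
  then have "B ** X - P ** (B ** X) = (C ** X - P ** (C ** X)) + (E ** X - P ** (E ** X))"
    by (rule dist)
  moreover have "F ** X = C ** X - P ** (C ** X)"
    by (rule vec_eq_iff[THEN iffD2])
       (simp add: F_def matrix_mult_row vector_matrix_mult_diff_distrib vector_matrix_mul_assoc)
  ultimately have "F ** X = (B ** X - P ** (B ** X)) - (E ** X - P ** (E ** X))" by simp
  then have "norm (F ** X) \<le> norm (B ** X - P ** (B ** X)) + norm (E ** X - P ** (E ** X))"
    by (simp add: norm_triangle_ineq4)
  also have "\<dots> \<le> norm (E ** X) + norm (E ** X)"
    using opt norm_diff_matrix_projection_le[OF U, of "E ** X"] by (simp add: P_def E_def)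
  finally have "norm (F ** X) \<le> 2 * norm (E ** X)" by simp
  then have FX: "t * norm (F ** X) \<le> t * (2 * norm (E ** X))" using t(1) by (rule mult_left_mono)
  have "B - P ** B = F + (E - P ** E)"
    unfolding F_def by (rule dist) (simp add: E_def)
  then have "norm (B - P ** B) \<le> norm F + norm (E - P ** E)"
    by (simp add: norm_triangle_ineq)
  also have "\<dots> \<le> t * (2 * norm (E ** X)) + norm E"
    using F FX norm_diff_matrix_projection_le[OF U, of E] by (simp add: P_def)
  finally show ?thesis by (simp add: P_def E_def algebra_simps)
qed

text \<open>The inequality is closed in \<open>v\<close>, so it extends from \<open>D\<close> to its
  closure. This allows a countable \<open>D\<close>, for which the supremum is measurable.\<close>

lemma norm_le_sup_gain:
  fixes X :: "real ^ 'q ^ 'p"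
  assumes D: "V \<subseteq> closure D" and fin: "(SUP v\<in>D. (gain v X)\<^sup>2) = ennreal r" and r: "r \<ge> 0" and v: "v \<in> V"
  shows "norm v \<le> sqrt r * norm (v v* X)"
proof -
  have "closed {v. norm v \<le> sqrt r * norm (v v* X)}"
  proof (rule closed_Collect_le)
    show "continuous_on UNIV (\<lambda>v. sqrt r * norm (v v* X))"
      using vector_matrix_linear_left[of X]
      by (intro continuous_intros linear_continuous_on) (simp add: linear_conv_bounded_linear)
  qed (intro continuous_intros)
  moreover have "D \<subseteq> {v. norm v \<le> sqrt r * norm (v v* X)}"
  proof safe
    fix v assume "v \<in> D"
    then have le: "(gain v X)\<^sup>2 \<le> ennreal r" unfolding fin[symmetric] by (rule SUP_upper)
    show "norm v \<le> sqrt r * norm (v v* X)"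
    proof (cases "norm (v v* X) = 0")
      case True
      have "v = 0"
      proof (rule ccontr)
        assume "v \<noteq> 0"
        then have "gain v X = \<top>" using True by (simp add: gain_def)
        then show False using le by (simp add: top_unique)
      qed
      then show ?thesis by simp
    next
      case False
      then have pos: "norm (v v* X) > 0" by simp
      have "(gain v X)\<^sup>2 = ennreal ((norm v / norm (v v* X))\<^sup>2)"
        unfolding gain_def by (subst divide_ennreal) (use pos in \<open>simp_all add: ennreal_power\<close>)
      then have "(norm v / norm (v v* X))\<^sup>2 \<le> r" using le r by simp
      then have "norm v / norm (v v* X) \<le> sqrt r" by (rule real_le_rsqrt)
      then show ?thesis using pos by (simp add: pos_divide_le_eq)
    qed
  qed
  ultimately have "closure D \<subseteq> {v. norm v \<le> sqrt r * norm (v v* X)}" by (rule closure_minimal[rotated])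
  then show ?thesis using D v by auto
qed

text \<open>The cross term is split with weight \<open>L\<close>. If \<open>w\<^sup>2\<close> has
  mean at most \<open>L\<^sup>2 * a\<^sup>2\<close>, the right side has mean at most
  \<open>(1 + 2 * L)\<^sup>2 * a\<^sup>2\<close>, so this pointwise bound does the work of
  Minkowski's inequality.\<close>

lemma square_sum_le_weighted:
  fixes a w L :: real
  assumes L: "L > 0"
  shows "(a + 2 * w)\<^sup>2 \<le> (1 + 2 * L) * a\<^sup>2 + (4 + 2 / L) * w\<^sup>2"
proof -
  have "0 \<le> (2 / L) * (L * a - w)\<^sup>2" using L by simp
  also have "\<dots> = 2 * L * a\<^sup>2 - 4 * a * w + (2 / L) * w\<^sup>2"
    using L by (simp add: power2_eq_square field_simps)
  finally show ?thesis by (simp add: power2_eq_square algebra_simps)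
qed

theorem theorem4p2:
  fixes M :: "'a measure"
    and B :: "real ^ 'p ^ 'm"
    and \<Omega> :: "'a \<Rightarrow> real ^ 'q ^ 'p"
    and U :: "'a \<Rightarrow> real ^ 'k ^ 'm"
  assumes "prob_space M"
    and "std_gaussian_matrix M \<Omega>"
    and "\<And>\<omega>. \<omega> \<in> space M \<Longrightarrow> top_left_singular_vectors (B ** \<Omega> \<omega>) (U \<omega>)"
    and "(\<lambda>\<omega>. (frobenius_norm (B - U \<omega> ** transpose (U \<omega>) ** B))\<^sup>2) \<in> borel_measurable M"
    and "CARD('q) \<ge> CARD('k) + 2"
  shows "integrable M (\<lambda>\<omega>. (frobenius_norm (B - U \<omega> ** transpose (U \<omega>) ** B))\<^sup>2) \<and>
    prob_space.expectation M (\<lambda>\<omega>. (frobenius_norm (B - U \<omega> ** transpose (U \<omega>) ** B))\<^sup>2)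
      \<le> (1 + 2 * exp 1 * real CARD('q) /
              sqrt ((real CARD('q) - real CARD('k))\<^sup>2 - 1))\<^sup>2 *
         (frobenius_norm (B - best_rank_approx CARD('k) B))\<^sup>2"
proof -
  interpret M: prob_space M by fact
  have \<Omega>[measurable]: "\<Omega> \<in> borel_measurable M" and distr: "distr M borel \<Omega> = gauss"
    using std_gaussian_matrix_distr assms(1,2) by blast+
  define k where "k = CARD('k)"
  define d where "d = CARD('q) - k"
  have k: "k \<ge> 1" "k + d = CARD('q)" and d: "d \<ge> 2"
    using assms(5) by (auto simp: k_def d_def Suc_le_eq)
  define K where "K = best_rank_approx k B"
  have rankK: "rank K \<le> k"
    using best_rank_approx[of k B] by (simp add: K_def is_best_rank_approx_def)
  define V where "V = span (rows K)"
  have V: "subspace V" "dim V \<le> k"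
    using rankK by (simp_all add: V_def row_rank_def)
  obtain S where S: "S \<subseteq> V" "pairwise orthogonal S" "\<And>x. x \<in> S \<Longrightarrow> norm x = 1"
      "independent S" "span S = V"
    using V(1) by (metis orthonormal_basis_subspace)
  interpret S: orthonormal_set S
    using S independent_imp_finite by unfold_locales auto
  obtain D where D: "countable D" "D \<subseteq> V" "V \<subseteq> closure D"
    by (rule separable)
  \<comment> \<open>Projecting the rows of \<open>B\<close> to \<open>V\<close>, instead of taking
    \<open>K\<close> itself, makes the rows of \<open>E\<close> orthogonal to \<open>V\<close>, as
    independence requires; the residual does not grow.\<close>
  define C where "C = (\<chi> i. onproj S (B $ i))"
  define E where "E = B - C"
  have CV: "C $ i \<in> V" for i using onproj_in_span[of S "B $ i"] S(5) by (simp add: C_def)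
  have E0: "onproj S (E $ i) = 0" for i
    by (simp add: E_def C_def linear_diff[OF onproj_linear] S.onproj_idem)
  have "norm E \<le> norm (B - K)"
    unfolding norm_vec_def[of E] norm_vec_def[of "B - K"]
  proof (rule L2_set_mono)
    fix i
    have "K $ i \<in> span S"
      unfolding S(5) V_def by (rule span_base) (auto simp: rows_def row_def vec_nth_inverse)
    then show "norm (E $ i) \<le> norm ((B - K) $ i)"
      by (simp add: E_def C_def S.norm_diff_onproj_le)
  qed simp
  then have EK: "norm E \<le> frobenius_norm (B - best_rank_approx CARD('k) B)"
    by (simp add: K_def k_def frobenius_norm_eq_norm)
  have rankC: "rank C \<le> k"
  proof -
    have "rows C \<subseteq> V" using CV by (auto simp: rows_def row_def)
    then have "rank C \<le> dim V" unfolding row_rank_def by (rule dim_subset)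
    then show ?thesis using V(2) by simp
  qed
  define f where "f = (\<lambda>\<omega>. (frobenius_norm (B - U \<omega> ** transpose (U \<omega>) ** B))\<^sup>2)"
  have [measurable]: "f \<in> borel_measurable M" using assms(4) by (simp add: f_def)
  define G where "G = (\<lambda>X :: real ^ 'q ^ 'p. SUP v\<in>D. (gain v X)\<^sup>2)"
  have [measurable]: "G \<in> borel_measurable borel"
    unfolding G_def using D(1) by measurable
  \<comment> \<open>\<open>L\<^sup>2\<close> is the bound on the mean of \<tau> squared times the
    number of columns of \<open>\<Omega> \<omega>\<close>, and \<open>2 * L\<close> is the fraction
    in the theorem.\<close>
  define L where "L = exp 1 * real CARD('q) / sqrt ((real d)\<^sup>2 - 1)"
  have "2 ^ 2 \<le> (real d) ^ 2" using d by (intro power_mono) auto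
  then have d1: "(real d)\<^sup>2 - 1 > 0" by simp
  then have L: "L > 0" by (simp add: L_def)
  have Lsq: "(exp 1)\<^sup>2 * real CARD('q) / ((real d)\<^sup>2 - 1) * real CARD('q) = L\<^sup>2"
    using d1 by (simp add: L_def power_divide power_mult_distrib) (simp add: power2_eq_square)
  \<comment> \<open>This removes \<open>U\<close>: the right side is a measurable function of
    \<open>\<Omega> \<omega>\<close> alone and can be integrated against
    \<open>gauss\<close>.\<close>
  have bound: "ennreal (f \<omega>) \<le> ennreal ((1 + 2 * L) * (norm E)\<^sup>2) +
      ennreal (4 + 2 / L) * (G (\<Omega> \<omega>) * ennreal ((norm (E ** \<Omega> \<omega>))\<^sup>2))"
    if \<omega>: "\<omega> \<in> space M" and fin: "G (\<Omega> \<omega>) < \<infinity>" for \<omega>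
  proof -
    obtain r where r: "G (\<Omega> \<omega>) = ennreal r" "r \<ge> 0" using fin by (cases "G (\<Omega> \<omega>)") auto
    let ?X = "\<Omega> \<omega>" and ?U = "U \<omega>"
    define w where "w = sqrt r * norm (E ** ?X)"
    have top: "top_left_singular_vectors (B ** ?X) ?U" using assms(3) \<omega> .
    have U: "transpose ?U ** ?U = mat 1" using top by (simp add: top_left_singular_vectors_def)
    have "norm (B ** ?X - ?U ** transpose ?U ** (B ** ?X)) =
        norm (B ** ?X - best_rank_approx k (B ** ?X))"
      using top by (simp add: top_left_singular_vectors_def frobenius_norm_eq_norm k_def)
    \<comment> \<open>\<open>C ** ?X\<close> has rank at most \<open>k\<close>, so it competes with
      the best approximation of \<open>B ** ?X\<close>.\<close>
    also have "\<dots> \<le> norm (B ** ?X - C ** ?X)"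
      using best_rank_approx[of k "B ** ?X"] rank_mul_le_left[of C ?X] rankC
      by (simp add: is_best_rank_approx_def frobenius_norm_eq_norm)
    also have "B ** ?X - C ** ?X = (B - C) ** ?X"
      by (rule vec_eq_iff[THEN iffD2]) (simp add: matrix_mult_row vector_matrix_mult_diff_distrib)
    finally have "norm (B - ?U ** transpose ?U ** B) \<le> norm (B - C) + 2 * (sqrt r * norm ((B - C) ** ?X))"
      using norm_le_sup_gain[OF D(3) r(1)[unfolded G_def] r(2)] r(2)
      by (intro projection_error_le[OF U _ V(1) CV]) auto
    then have "(norm (B - ?U ** transpose ?U ** B))\<^sup>2 \<le> (norm E + 2 * w)\<^sup>2"
      by (intro power_mono) (simp_all add: E_def w_def)
    also have "\<dots> \<le> (1 + 2 * L) * (norm E)\<^sup>2 + (4 + 2 / L) * w\<^sup>2"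
      by (rule square_sum_le_weighted[OF L])
    also have "w\<^sup>2 = r * (norm (E ** ?X))\<^sup>2"
      using r(2) by (simp add: w_def power_mult_distrib)
    finally have "f \<omega> \<le> (1 + 2 * L) * (norm E)\<^sup>2 + (4 + 2 / L) * (r * (norm (E ** ?X))\<^sup>2)"
      by (simp add: f_def frobenius_norm_eq_norm)
    then have "ennreal (f \<omega>) \<le> ennreal ((1 + 2 * L) * (norm E)\<^sup>2 + (4 + 2 / L) * (r * (norm (E ** ?X))\<^sup>2))"
      by (rule ennreal_leI)
    also have "\<dots> = ennreal ((1 + 2 * L) * (norm E)\<^sup>2) + ennreal (4 + 2 / L) * (G ?X * ennreal ((norm (E ** ?X))\<^sup>2))"
      using L r(2) by (subst ennreal_plus) (simp_all add: r(1) ennreal_mult')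
    finally show ?thesis .
  qed
  \<comment> \<open>The pointwise bound requires finite \<tau>, which holds almost surely.\<close>
  have "AE X in distr M borel \<Omega>. G X < \<infinity>"
    unfolding distr G_def using V k d D by (intro nn_integral_gauss_sup_gain_square_le(2)) auto
  then have "AE \<omega> in M. G (\<Omega> \<omega>) < \<infinity>"
    by (rule AE_distrD[rotated]) simp
  then have "AE \<omega> in M. ennreal (f \<omega>) \<le> ennreal ((1 + 2 * L) * (norm E)\<^sup>2) +
      ennreal (4 + 2 / L) * (G (\<Omega> \<omega>) * ennreal ((norm (E ** \<Omega> \<omega>))\<^sup>2))"
    using AE_space by eventually_elim (rule bound)
  then have "(\<integral>\<^sup>+\<omega>. ennreal (f \<omega>) \<partial>M) \<le> (\<integral>\<^sup>+\<omega>. ennreal ((1 + 2 * L) * (norm E)\<^sup>2) +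
      ennreal (4 + 2 / L) * (G (\<Omega> \<omega>) * ennreal ((norm (E ** \<Omega> \<omega>))\<^sup>2)) \<partial>M)"
    by (rule nn_integral_mono_AE)
  also have "\<dots> = (\<integral>\<^sup>+X. ennreal ((1 + 2 * L) * (norm E)\<^sup>2) +
      ennreal (4 + 2 / L) * (G X * ennreal ((norm (E ** X))\<^sup>2)) \<partial>(distr M borel \<Omega>))"
    by (subst nn_integral_distr) simp_all
  also have "\<dots> = ennreal ((1 + 2 * L) * (norm E)\<^sup>2) +
      ennreal (4 + 2 / L) * (\<integral>\<^sup>+X. G X * ennreal ((norm (E ** X))\<^sup>2) \<partial>gauss)"
    unfolding distr using gauss.emeasure_space_1[where ?'a="real ^ 'q ^ 'p"]
    by (subst nn_integral_add) (simp_all add: nn_integral_cmult)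
  also have "(\<integral>\<^sup>+X. G X * ennreal ((norm (E ** X))\<^sup>2) \<partial>gauss) =
      (\<integral>\<^sup>+X. G X \<partial>gauss) * ennreal (real CARD('q) * (norm E)\<^sup>2)"
    unfolding G_def using D S(5) E0
    by (intro nn_integral_gauss_gain_independent[of S]) (auto intro: S.orthonormal_set_axioms)
  also have "ennreal ((1 + 2 * L) * (norm E)\<^sup>2) +
      ennreal (4 + 2 / L) * ((\<integral>\<^sup>+X. G X \<partial>gauss) * ennreal (real CARD('q) * (norm E)\<^sup>2)) \<le>
      ennreal ((1 + 2 * L) * (norm E)\<^sup>2) + ennreal (4 + 2 / L) *
        (ennreal ((exp 1)\<^sup>2 * real CARD('q) / ((real d)\<^sup>2 - 1)) * ennreal (real CARD('q) * (norm E)\<^sup>2))"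
    unfolding G_def using V k d D
    by (intro add_left_mono mult_left_mono mult_right_mono nn_integral_gauss_sup_gain_square_le(1)) auto
  also have "\<dots> = ennreal ((1 + 2 * L) * (norm E)\<^sup>2 + (4 + 2 / L) *
        ((exp 1)\<^sup>2 * real CARD('q) / ((real d)\<^sup>2 - 1) * (real CARD('q) * (norm E)\<^sup>2)))"
    using L d1 by (subst ennreal_plus) (simp_all add: ennreal_mult'[symmetric] del: ennreal_plus)
  \<comment> \<open>By \<open>Lsq\<close> the second term is
    \<open>(4 + 2 / L) * L\<^sup>2 = 4 * L\<^sup>2 + 2 * L\<close> times the squared norm of
    \<open>E\<close>, which completes the square.\<close>
  also have "(1 + 2 * L) * (norm E)\<^sup>2 + (4 + 2 / L) *
        ((exp 1)\<^sup>2 * real CARD('q) / ((real d)\<^sup>2 - 1) * (real CARD('q) * (norm E)\<^sup>2)) =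
      (1 + 2 * L)\<^sup>2 * (norm E)\<^sup>2"
    unfolding mult.assoc[symmetric, of _ "real CARD('q)" "(norm E)\<^sup>2"] Lsq
    using L by (simp add: power2_eq_square algebra_simps)
  finally have "(\<integral>\<^sup>+\<omega>. ennreal (f \<omega>) \<partial>M) \<le> ennreal ((1 + 2 * L)\<^sup>2 * (norm E)\<^sup>2)" .
  also have "\<dots> \<le> ennreal ((1 + 2 * L)\<^sup>2 * (frobenius_norm (B - best_rank_approx CARD('k) B))\<^sup>2)"
    using EK by (intro ennreal_leI mult_left_mono power_mono) auto
  finally have le: "(\<integral>\<^sup>+\<omega>. ennreal (f \<omega>) \<partial>M) \<le>
    ennreal ((1 + 2 * L)\<^sup>2 * (frobenius_norm (B - best_rank_approx CARD('k) B))\<^sup>2)" .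
  have f0: "f \<omega> \<ge> 0" for \<omega> by (simp add: f_def)
  have int: "integrable M f"
  proof (rule integrableI_bounded)
    show "(\<integral>\<^sup>+\<omega>. ennreal (norm (f \<omega>)) \<partial>M) < \<infinity>"
      using le f0 by (simp add: le_less_trans[OF _ ennreal_less_top])
  qed simp
  have "ennreal (integral\<^sup>L M f) \<le>
      ennreal ((1 + 2 * L)\<^sup>2 * (frobenius_norm (B - best_rank_approx CARD('k) B))\<^sup>2)"
    using le nn_integral_eq_integral[OF int] f0 by simp
  then have "integral\<^sup>L M f \<le> (1 + 2 * L)\<^sup>2 * (frobenius_norm (B - best_rank_approx CARD('k) B))\<^sup>2"
    by simp
  moreover have "2 * L = 2 * exp 1 * real CARD('q) / sqrt ((real CARD('q) - real CARD('k))\<^sup>2 - 1)"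
    using assms(5) by (simp add: L_def d_def k_def of_nat_diff)
  ultimately show ?thesis
    using int by (simp add: f_def)
qed

end
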